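(* Let $G$ be a finite regular partial cube that is not isomorphic to $K_1$ or $K_2$. Then every convex cycle of $G$ is a $4$-cycle if and only if $G$ is isomorphic to a hypercube $Q_k$ for some $k\geqslant 2$.
   Context: All graphs are finite, simple and undirected. The hypercube $Q_n$ has as vertices all 0-1 sequences of length $n$, two being adjacent iff they differ in exactly one position. A subgraph $H$ of $G$ is isometric if $d_H(u,v)=d_G(u,v)$ for all $u,v\in V(H)$, and convex if moreover every shortest $u,v$-path in $G$ (for $u,v\in V(H)$) lies in $H$. A partial cube is a graph isomorphic to an isometric subgraph of some hypercube $Q_n$. A convex cycle is a cycle that is a convex subgraph; an $l$-cycle is a cycle with $l$ edges. A graph is regular if all its vertices have the same degree. *)

theory Defs
  imports Main "HOL-Library.Extended_Nat"
begin

definition simple_graph :: "'a set \<Rightarrow> ('a \<times> 'a) set \<Rightarrow> bool" where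
  "simple_graph V E \<longleftrightarrow> E \<subseteq> V \<times> V \<and> sym E \<and> (\<forall>v. (v, v) \<notin> E)"

definition finite_graph :: "'a set \<Rightarrow> ('a \<times> 'a) set \<Rightarrow> bool" where
  "finite_graph V E \<longleftrightarrow> simple_graph V E \<and> finite V \<and> V \<noteq> {}"

definition is_walk :: "'a set \<Rightarrow> ('a \<times> 'a) set \<Rightarrow> 'a list \<Rightarrow> 'a \<Rightarrow> 'a \<Rightarrow> bool" where
  "is_walk V E p u v \<longleftrightarrow> p \<noteq> [] \<and> hd p = u \<and> last p = v \<and> set p \<subseteq> V \<and>
     (\<forall>i. Suc i < length p \<longrightarrow> (p ! i, p ! Suc i) \<in> E)"

text \<open>Graph distance (infinite if no walk exists).\<close>
definition gdist :: "'a set \<Rightarrow> ('a \<times> 'a) set \<Rightarrow> 'a \<Rightarrow> 'a \<Rightarrow> enat" where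
  "gdist V E u v = (INF p \<in> {p. is_walk V E p u v}. enat (length p - 1))"

text \<open>Shortest u,v-walks (these are automatically paths).\<close>
definition shortest_path :: "'a set \<Rightarrow> ('a \<times> 'a) set \<Rightarrow> 'a list \<Rightarrow> 'a \<Rightarrow> 'a \<Rightarrow> bool" where
  "shortest_path V E p u v \<longleftrightarrow> is_walk V E p u v \<and> enat (length p - 1) = gdist V E u v"

definition subgraph :: "'a set \<Rightarrow> ('a \<times> 'a) set \<Rightarrow> 'a set \<Rightarrow> ('a \<times> 'a) set \<Rightarrow> bool" where
  "subgraph H F V E \<longleftrightarrow> H \<subseteq> V \<and> F \<subseteq> E \<and> F \<subseteq> H \<times> H"

definition isometric_subgraph :: "'a set \<Rightarrow> ('a \<times> 'a) set \<Rightarrow> 'a set \<Rightarrow> ('a \<times> 'a) set \<Rightarrow> bool" where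
  "isometric_subgraph H F V E \<longleftrightarrow> subgraph H F V E \<and>
     (\<forall>u\<in>H. \<forall>v\<in>H. gdist H F u v = gdist V E u v)"

definition convex_subgraph :: "'a set \<Rightarrow> ('a \<times> 'a) set \<Rightarrow> 'a set \<Rightarrow> ('a \<times> 'a) set \<Rightarrow> bool" where
  "convex_subgraph H F V E \<longleftrightarrow> isometric_subgraph H F V E \<and>
     (\<forall>u\<in>H. \<forall>v\<in>H. \<forall>p. shortest_path V E p u v \<longrightarrow>
        set p \<subseteq> H \<and> (\<forall>i. Suc i < length p \<longrightarrow> (p ! i, p ! Suc i) \<in> F))"

definition graph_iso :: "'a set \<Rightarrow> ('a \<times> 'a) set \<Rightarrow> 'b set \<Rightarrow> ('b \<times> 'b) set \<Rightarrow> bool" where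
  "graph_iso V E W D \<longleftrightarrow> (\<exists>f. bij_betw f V W \<and>
     (\<forall>u\<in>V. \<forall>v\<in>V. (u, v) \<in> E \<longleftrightarrow> (f u, f v) \<in> D))"

definition cube_V :: "nat \<Rightarrow> bool list set" where
  "cube_V n = {xs. length xs = n}"

definition cube_E :: "nat \<Rightarrow> (bool list \<times> bool list) set" where
  "cube_E n = {(xs, ys). length xs = n \<and> length ys = n \<and> card {i. i < n \<and> xs ! i \<noteq> ys ! i} = 1}"

definition partial_cube :: "'a set \<Rightarrow> ('a \<times> 'a) set \<Rightarrow> bool" where
  "partial_cube V E \<longleftrightarrow> (\<exists>n H F. isometric_subgraph H F (cube_V n) (cube_E n) \<and> graph_iso V E H F)"

definition cycle_graph :: "'a set \<Rightarrow> ('a \<times> 'a) set \<Rightarrow> nat \<Rightarrow> bool" where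
  "cycle_graph C F l \<longleftrightarrow> 3 \<le> l \<and> (\<exists>c. length c = l \<and> distinct c \<and> C = set c \<and>
     F = {(c ! i, c ! ((i + 1) mod l)) | i. i < l} \<union> {(c ! ((i + 1) mod l), c ! i) | i. i < l})"

definition convex_cycle :: "'a set \<Rightarrow> ('a \<times> 'a) set \<Rightarrow> 'a set \<Rightarrow> ('a \<times> 'a) set \<Rightarrow> nat \<Rightarrow> bool" where
  "convex_cycle V E C F l \<longleftrightarrow> cycle_graph C F l \<and> convex_subgraph C F V E"

definition regular :: "'a set \<Rightarrow> ('a \<times> 'a) set \<Rightarrow> bool" where
  "regular V E \<longleftrightarrow> (\<exists>d. \<forall>v\<in>V. card {u. (v, u) \<in> E} = d)"

definition K_V :: "nat \<Rightarrow> nat set" where "K_V n = {0..<n}"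
definition K_E :: "nat \<Rightarrow> (nat \<times> nat) set" where
  "K_E n = {(i, j). i < n \<and> j < n \<and> i \<noteq> j}"

end

theory Submission
  imports Defs
begin

text \<open>
  View the vertices as finite sets, adjacent when they differ in one element (the direction of the
  edge). Let all convex cycles be squares.

  Two parallel edges at distance \<open>\<ge> 1\<close> can be moved towards each other across a square: in a closest
  counterexample the interval spanned by the two edges is a convex cycle of length \<open>\<ge> 6\<close>. It follows
  that a path in which no two consecutive edges lie in a common square is a geodesic, so in a finite
  graph its length is bounded.

  On the other hand, let the edges in directions \<open>f\<close> and \<open>h\<close> at a vertex \<open>c\<close> not lie in a common
  square. Then \<open>h\<close> is a direction at \<open>c\<close> but not at the \<open>f\<close>-neighbour \<open>c'\<close> of \<open>c\<close>, so by regularity some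
  \<open>g\<close> is a direction at \<open>c'\<close> but not at \<open>c\<close>; the edges in directions \<open>f\<close> and \<open>g\<close> at \<open>c'\<close> again do not lie
  in a common square, and the path can be continued forever. Hence adjacent vertices have the same
  directions, and the graph is a cube.
\<close>

section \<open>Isometric families of sets\<close>

definition sdiff :: "'b set \<Rightarrow> 'b set \<Rightarrow> 'b set" (infixl \<open>\<triangle>\<close> 70) where
  "A \<triangle> B = (A - B) \<union> (B - A)"

lemma in_sdiff [simp]: "x \<in> A \<triangle> B \<longleftrightarrow> (x \<in> A) \<noteq> (x \<in> B)"
  by (auto simp: sdiff_def)

lemma sdiff_commute: "A \<triangle> B = B \<triangle> A"
  by (auto simp: sdiff_def)

lemma sdiff_assoc: "A \<triangle> B \<triangle> C = A \<triangle> (B \<triangle> C)"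
  by (rule set_eqI) auto

lemma sdiff_left_commute: "A \<triangle> (B \<triangle> C) = B \<triangle> (A \<triangle> C)"
  by (rule set_eqI) auto

lemmas sdiff_ac = sdiff_assoc sdiff_commute sdiff_left_commute

lemma sdiff_self [simp]: "A \<triangle> A = {}"
  by (simp add: sdiff_def)

lemma sdiff_empty [simp]: "A \<triangle> {} = A" "{} \<triangle> A = A"
  by (simp_all add: sdiff_def)

lemma sdiff_cancel [simp]: "A \<triangle> (A \<triangle> B) = B"
  by (rule set_eqI) auto

lemma sdiff_cancel_right [simp]: "A \<triangle> B \<triangle> B = A"
  by (rule set_eqI) auto

lemma sdiff_eq_empty [simp]: "A \<triangle> B = {} \<longleftrightarrow> A = B"
  by (auto simp: sdiff_def)

lemma sdiff_cancel_iff [simp]: "A \<triangle> B = A \<triangle> C \<longleftrightarrow> B = C"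
  by (metis sdiff_cancel)

lemma sdiff_translate [simp]: "(A \<triangle> B) \<triangle> (A \<triangle> C) = B \<triangle> C"
  by (rule set_eqI) auto

lemma finite_sdiff [simp]: "finite A \<Longrightarrow> finite B \<Longrightarrow> finite (A \<triangle> B)"
  by (simp add: sdiff_def)

lemma sdiff_singleton: "A \<triangle> {a} = (if a \<in> A then A - {a} else insert a A)"
  by (auto simp: sdiff_def)

section \<open>Isometric families and their cycles\<close>

text \<open>For a family of finite sets this says that it induces an isometric subgraph of the cube.\<close>

definition isometric_family :: "'b set set \<Rightarrow> bool" where
  "isometric_family X \<longleftrightarrow> (\<forall>A\<in>X. \<forall>B\<in>X. A \<noteq> B \<longrightarrow> (\<exists>a\<in>A \<triangle> B. A \<triangle> {a} \<in> X))"

text \<open>The closed walk that starts at \<open>{}\<close>, adds the elements of \<open>xs\<close> one by one and then removes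
  them in the same order.\<close>

definition cycle_sets :: "'b list \<Rightarrow> 'b set set" where
  "cycle_sets xs = (\<lambda>i. set (take i xs)) ` {..length xs} \<union> (\<lambda>i. set (drop i xs)) ` {..length xs}"

text \<open>The subcube at \<open>u\<close> spanned by \<open>set xs\<close> must not meet
  \<open>X\<close> in exactly a cycle of length \<open>2 * length xs\<close>; a cycle cut out by a
  subcube is convex. Two directions would give a square, hence the bound \<open>3\<close>.\<close>

definition long_cycle_free :: "'b set set \<Rightarrow> bool" where
  "long_cycle_free X \<longleftrightarrow> (\<forall>u\<in>X. \<forall>xs. distinct xs \<longrightarrow> 3 \<le> length xs \<longrightarrow>
     {Z. Z \<subseteq> set xs \<and> u \<triangle> Z \<in> X} \<noteq> cycle_sets xs)"

lemma isometric_familyD: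
  "isometric_family X \<Longrightarrow> A \<in> X \<Longrightarrow> B \<in> X \<Longrightarrow> A \<noteq> B \<Longrightarrow> \<exists>a\<in>A \<triangle> B. A \<triangle> {a} \<in> X"
  by (simp add: isometric_family_def)

text \<open>Any vertex \<open>u\<close> can thus be moved to \<open>{}\<close>, where every set is
  its own difference to the base vertex.\<close>

lemma isometric_family_translate:
  assumes "isometric_family X"
  shows "isometric_family {Z. u \<triangle> Z \<in> X}"
  unfolding isometric_family_def
proof (intro ballI impI)
  fix A B assume "A \<in> {Z. u \<triangle> Z \<in> X}" "B \<in> {Z. u \<triangle> Z \<in> X}" "A \<noteq> B"
  then have "\<exists>a\<in>(u \<triangle> A) \<triangle> (u \<triangle> B). u \<triangle> A \<triangle> {a} \<in> X"
    by (intro isometric_familyD[OF assms]) simp_all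
  then show "\<exists>a\<in>A \<triangle> B. A \<triangle> {a} \<in> {Z. u \<triangle> Z \<in> X}"
    unfolding sdiff_translate by (simp only: sdiff_assoc mem_Collect_eq)
qed

text \<open>Each removed element is put at the end of the list, so the sets left over are its
  prefixes. With membership in a family for \<open>P\<close>, the prefixes trace a geodesic from
  \<open>{}\<close> to \<open>B\<close>.\<close>

lemma chain_of_removals:
  assumes "finite B" "P B"
    and step: "\<And>Z. P Z \<Longrightarrow> Z \<subseteq> B \<Longrightarrow> Z \<noteq> {} \<Longrightarrow> \<exists>a\<in>Z. P (Z - {a})"
  shows "\<exists>xs. distinct xs \<and> set xs = B \<and> (\<forall>i. P (set (take i xs)))"
  using assms
proof (induction B rule: finite_psubset_induct)
  case (psubset B)
  show ?case
  proof (cases "B = {}")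
    case True
    then show ?thesis using psubset.prems by (intro exI[of _ "[]"]) auto
  next
    case False
    then obtain a where a: "a \<in> B" "P (B - {a})" using psubset.prems by blast
    have "\<exists>xs. distinct xs \<and> set xs = B - {a} \<and> (\<forall>i. P (set (take i xs)))"
    proof (rule psubset.IH)
      show "\<exists>b\<in>Z. P (Z - {b})" if "P Z" "Z \<subseteq> B - {a}" "Z \<noteq> {}" for Z
        using psubset.prems(2)[of Z] that by blast
    qed (use a in auto)
    then obtain xs where xs: "distinct xs" "set xs = B - {a}" "\<forall>i. P (set (take i xs))" by blast
    have "P (set (take i (xs @ [a])))" for i
    proof (cases "i \<le> length xs")
      case True
      then show ?thesis using xs by simp
    next
      case False
      then have "set (take i (xs @ [a])) = B" using xs a by auto
      then show ?thesis using psubset.prems by simp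
    qed
    then show ?thesis using xs a by (intro exI[of _ "xs @ [a]"]) auto
  qed
qed

lemma subsets_insert_Collect:
  "{Z. Z \<subseteq> insert e B \<and> P Z} = {Z. Z \<subseteq> B \<and> P Z} \<union> insert e ` {Z. Z \<subseteq> B \<and> P (insert e Z)}"
proof -
  have "{Z. Z \<subseteq> insert e B \<and> P Z} = {Z \<in> Pow (insert e B). P Z}" by auto
  also have "\<dots> = {Z. Z \<subseteq> B \<and> P Z} \<union> insert e ` {Z. Z \<subseteq> B \<and> P (insert e Z)}"
    unfolding Pow_insert by auto
  finally show ?thesis .
qed

section \<open>Moving parallel edges towards each other\<close>

text \<open>In a minimal counterexample no edge in direction \<open>e\<close> lies strictly between
  the two given ones. The sets of the interval without \<open>e\<close> then form a single geodesic,
  those with \<open>e\<close> the complementary one, and the two given edges close them up to a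
  forbidden cycle.\<close>

lemma parallel_edges_step_at_empty:
  fixes X :: "'b set set"
  assumes iso: "isometric_family X"
    and lcf: "\<And>xs. distinct xs \<Longrightarrow> 3 \<le> length xs \<Longrightarrow> {Z. Z \<subseteq> set xs \<and> Z \<in> X} \<noteq> cycle_sets xs"
    and e0: "{} \<in> X" "{e} \<in> X"
  shows "finite B \<Longrightarrow> B \<noteq> {} \<Longrightarrow> e \<notin> B \<Longrightarrow> B \<in> X \<Longrightarrow> insert e B \<in> X
    \<Longrightarrow> \<exists>a\<in>B. {a} \<in> X \<and> {a, e} \<in> X"
proof (induction B rule: finite_psubset_induct)
  case (psubset B)
  show ?case
  proof (rule ccontr)
    assume neg: "\<not> ?thesis"
    \<comment> \<open>For a nonempty proper subset \<open>Z\<close> of \<open>B\<close> the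
      induction hypothesis would give a square at \<open>{}\<close> in some direction of
      \<open>Z\<close>, contrary to \<open>neg\<close>.\<close>
    have meet: "Z = {} \<or> Z = B" if "Z \<subseteq> B" "Z \<in> X" "insert e Z \<in> X" for Z
    proof (rule ccontr)
      assume "\<not> ?thesis"
      then have "\<exists>a\<in>Z. {a} \<in> X \<and> {a, e} \<in> X"
        using that psubset.prems by (intro psubset.IH) auto
      with that(1) neg show False by blast
    qed
    txt \<open>A geodesic from \<open>Z\<close> to \<open>insert e Z'\<close> crosses the direction \<open>e\<close> at \<open>{}\<close> or at \<open>B\<close>.\<close>
    have disj_or_cover: "Z \<inter> Z' = {} \<or> Z \<union> Z' = B"
      if "Z \<subseteq> B" "Z' \<subseteq> B" "Z \<in> X" "insert e Z' \<in> X" for Z Z'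
      using that
    proof (induction "card (Z \<triangle> Z')" arbitrary: Z rule: less_induct)
      case less
      have "Z \<noteq> insert e Z'" using less.prems psubset.prems by auto
      then obtain a where a: "a \<in> Z \<triangle> insert e Z'" "Z \<triangle> {a} \<in> X"
        using isometric_familyD[OF iso] less.prems by metis
      show ?case
      proof (cases "a = e")
        case True
        then have "insert e Z \<in> X" using a less.prems psubset.prems by (auto simp: sdiff_singleton)
        then show ?thesis using meet less.prems by blast
      next
        case False
        then have aZ: "a \<in> Z \<triangle> Z'" using a by auto
        have "finite (Z \<triangle> Z')"
          using less.prems psubset.hyps(1) by (meson finite_sdiff finite_subset)
        moreover have "(Z \<triangle> {a}) \<triangle> Z' \<subset> Z \<triangle> Z'" using aZ by auto
        ultimately have "card ((Z \<triangle> {a}) \<triangle> Z') < card (Z \<triangle> Z')" by (rule psubset_card_mono)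
        moreover have "Z \<triangle> {a} \<subseteq> B" using aZ less.prems by auto
        ultimately have "(Z \<triangle> {a}) \<inter> Z' = {} \<or> (Z \<triangle> {a}) \<union> Z' = B"
          using less.hyps less.prems a by blast
        \<comment> \<open>If \<open>a\<close> leaves \<open>Z\<close>, the new union misses
          \<open>a\<close>, so the first alternative holds; if \<open>a\<close> enters
          \<open>Z\<close>, the new intersection contains \<open>a\<close>, so the second holds.
          Either one passes back to \<open>Z\<close>.\<close>
        then show ?thesis using aZ less.prems by (auto simp: sdiff_singleton split: if_splits)
      qed
    qed
    have "\<exists>a\<in>Z. Z - {a} \<in> X" if "Z \<in> X" "Z \<noteq> {}" for Z
      using isometric_familyD[OF iso that(1) e0(1) that(2)] by (auto simp: sdiff_singleton)
    then obtain xs where xs: "distinct xs" "set xs = B" "\<And>i. set (take i xs) \<in> X"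
      using chain_of_removals[of B "\<lambda>Z. Z \<in> X"] psubset.hyps(1) psubset.prems by metis
    \<comment> \<open>In the upper layer the target is \<open>{e}\<close> instead of
      \<open>{}\<close>, so the geodesic from \<open>insert e Z\<close> never removes
      \<open>e\<close>.\<close>
    have "\<exists>a\<in>Z. insert e (Z - {a}) \<in> X" if Z: "insert e Z \<in> X" "Z \<subseteq> B" "Z \<noteq> {}" for Z
    proof -
      have eZ: "e \<notin> Z" using Z psubset.prems by auto
      then have "insert e Z \<noteq> {e}" using Z by auto
      then obtain a where a: "a \<in> insert e Z \<triangle> {e}" "insert e Z \<triangle> {a} \<in> X"
        using isometric_familyD[OF iso Z(1) e0(2)] by blast
      with eZ have "a \<in> Z" "insert e Z \<triangle> {a} = insert e (Z - {a})"
        by (auto simp: sdiff_singleton)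
      with a show ?thesis by metis
    qed
    then obtain ys where ys: "distinct ys" "set ys = B" "\<And>i. insert e (set (take i ys)) \<in> X"
      using chain_of_removals[of B "\<lambda>Z. insert e Z \<in> X"] psubset.hyps(1) psubset.prems
      by metis
    define n where "n = card B"
    have len: "length xs = n" "length ys = n"
      using xs ys distinct_card[of xs] distinct_card[of ys] by (auto simp: n_def)
    \<comment> \<open>When the sizes add up to \<open>card B\<close>, being disjoint and covering
      \<open>B\<close> are equivalent, so \<open>disj_or_cover\<close> yields both.\<close>
    have compl: "Z' = B - Z"
      if "Z \<subseteq> B" "Z' \<subseteq> B" "Z \<in> X" "insert e Z' \<in> X" "card Z + card Z' = n" for Z Z'
    proof -
      have fin: "finite Z" "finite Z'" using that psubset.hyps(1) finite_subset by auto
      have "card (Z \<union> Z') + card (Z \<inter> Z') = card B"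
        using card_Un_Int[OF fin] that n_def by simp
      moreover have "Z \<union> Z' \<subseteq> B" using that by simp
      ultimately have "Z \<inter> Z' = {} \<and> Z \<union> Z' = B"
        using disj_or_cover[OF that(1-4)] card_subset_eq[OF psubset.hyps(1), of "Z \<union> Z'"] fin
        by (metis add_cancel_right_right add_0_right card.empty card_0_eq finite_Int)
      then show ?thesis by blast
    qed
    have take_card: "card (set (take i zs)) = i" if "i \<le> n" "distinct zs" "length zs = n" for i zs
      using that by (simp add: distinct_card)
    \<comment> \<open>A set of the lower layer and the prefix of \<open>xs\<close> of the same size
      are both complements of the same prefix of \<open>ys\<close>, so each size occurs only
      once.\<close>
    have low: "Z \<in> X \<longleftrightarrow> (\<exists>i\<le>n. Z = set (take i xs))" if "Z \<subseteq> B" for Z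
    proof
      assume Z: "Z \<in> X"
      have c: "card Z \<le> n" using that psubset.hyps(1) by (simp add: n_def card_mono)
      let ?Y = "set (take (n - card Z) ys)"
      have Y: "?Y \<subseteq> B" "card ?Y = n - card Z"
        using ys len take_card[of "n - card Z" ys] set_take_subset[of "n - card Z" ys] by auto
      have "?Y = B - Z" using compl[OF that Y(1) Z ys(3)] Y c by simp
      moreover have "?Y = B - set (take (card Z) xs)"
        using compl[of "set (take (card Z) xs)" ?Y] xs ys Y c take_card[of "card Z" xs] len
          set_take_subset[of "card Z" xs] by simp
      ultimately have "Z = set (take (card Z) xs)"
        using that set_take_subset[of "card Z" xs] xs(2) by blast
      then show "\<exists>i\<le>n. Z = set (take i xs)" using c by blast
    qed (use xs in auto)
    have drop_compl: "set (drop i xs) = B - set (take i xs)" for i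
    proof -
      have "set (take i xs) \<union> set (drop i xs) = B"
        using xs(2) by (metis append_take_drop_id set_append)
      moreover have "set (take i xs) \<inter> set (drop i xs) = {}"
        using xs(1) by (simp add: set_take_disj_set_drop_if_distinct)
      ultimately show ?thesis by blast
    qed
    \<comment> \<open>Every upper set is the complement of a prefix of \<open>xs\<close>, that is, a
      suffix of \<open>xs\<close>; conversely the prefixes of \<open>ys\<close> realise all these
      complements.\<close>
    have high: "insert e Z \<in> X \<longleftrightarrow> (\<exists>i\<le>n. Z = set (drop i xs))" if "Z \<subseteq> B" for Z
    proof
      assume Z: "insert e Z \<in> X"
      have c: "card Z \<le> n" using that psubset.hyps(1) by (simp add: n_def card_mono)
      have "Z = B - set (take (n - card Z) xs)"
        using compl[of "set (take (n - card Z) xs)" Z] xs Z that c take_card[of "n - card Z" xs] len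
          set_take_subset[of "n - card Z" xs] by simp
      then show "\<exists>i\<le>n. Z = set (drop i xs)" using drop_compl by (metis diff_le_self)
    next
      assume "\<exists>i\<le>n. Z = set (drop i xs)"
      then obtain i where i: "i \<le> n" "Z = B - set (take i xs)" using drop_compl by blast
      have "set (take (n - i) ys) = B - set (take i xs)"
        using compl[of "set (take i xs)" "set (take (n - i) ys)"] xs ys i len
          take_card[of i xs] take_card[of "n - i" ys]
          set_take_subset[of i xs] set_take_subset[of "n - i" ys] by simp
      then show "insert e Z \<in> X" using ys(3)[of "n - i"] i by simp
    qed
    \<comment> \<open>If \<open>B = {b}\<close>, the two given edges already form a square, with
      \<open>a = b\<close>.\<close>
    have "n \<noteq> 1"
    proof
      assume "n = 1"
      then obtain b where "B = {b}" by (metis n_def card_1_singletonE)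
      with neg psubset.prems show False by (simp add: insert_commute[of b e])
    qed
    moreover have "n \<noteq> 0" using psubset by (simp add: n_def)
    ultimately have long: "3 \<le> length (xs @ [e])" using len by simp
    have "{Z. Z \<subseteq> set (xs @ [e]) \<and> Z \<in> X} = cycle_sets (xs @ [e])"
    proof -
      \<comment> \<open>With \<open>e\<close> last, the walk climbs the lower layer, crosses to the
        upper one at \<open>B\<close>, descends there by removing \<open>xs\<close> in order and
        returns from \<open>{e}\<close> to \<open>{}\<close>. The prefix of length
        \<open>Suc n\<close> is also the suffix at \<open>0\<close>, and the suffix at
        \<open>Suc n\<close> is the prefix of length \<open>0\<close>.\<close>
      have "cycle_sets (xs @ [e]) =
        (\<lambda>i. set (take i xs)) ` {..n} \<union> (\<lambda>i. insert e (set (drop i xs))) ` {..n}"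
      proof -
        have "(\<lambda>i. set (take i (xs @ [e]))) ` {..n} = (\<lambda>i. set (take i xs)) ` {..n}"
          using len by (intro image_cong) auto
        then have T: "(\<lambda>i. set (take i (xs @ [e]))) ` {..Suc n} =
            insert (insert e (set xs)) ((\<lambda>i. set (take i xs)) ` {..n})"
          unfolding atMost_Suc image_insert using len by simp
        have "(\<lambda>i. set (drop i (xs @ [e]))) ` {..n} = (\<lambda>i. insert e (set (drop i xs))) ` {..n}"
          using len by (intro image_cong) auto
        then have D: "(\<lambda>i. set (drop i (xs @ [e]))) ` {..Suc n} =
            insert {} ((\<lambda>i. insert e (set (drop i xs))) ` {..n})"
          unfolding atMost_Suc image_insert using len by simp
        have "insert e (set xs) \<in> (\<lambda>i. insert e (set (drop i xs))) ` {..n}"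
          by (rule image_eqI[of _ _ 0]) simp_all
        moreover have "{} \<in> (\<lambda>i. set (take i xs)) ` {..n}"
          by (rule image_eqI[of _ _ 0]) simp_all
        moreover have "length (xs @ [e]) = Suc n" using len by simp
        ultimately show ?thesis unfolding cycle_sets_def using T D by auto
      qed
      moreover have "{Z. Z \<subseteq> set (xs @ [e]) \<and> Z \<in> X} =
          {Z. Z \<subseteq> B \<and> Z \<in> X} \<union> insert e ` {Z. Z \<subseteq> B \<and> insert e Z \<in> X}"
        using subsets_insert_Collect[of e B "\<lambda>Z. Z \<in> X"] xs(2) by simp
      moreover have "{Z. Z \<subseteq> B \<and> Z \<in> X} = (\<lambda>i. set (take i xs)) ` {..n}"
      proof -
        have "set (take i xs) \<subseteq> B" for i using xs(2) set_take_subset by metis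
        then show ?thesis using low by auto
      qed
      moreover have "insert e ` {Z. Z \<subseteq> B \<and> insert e Z \<in> X} =
          (\<lambda>i. insert e (set (drop i xs))) ` {..n}"
      proof -
        have "set (drop i xs) \<subseteq> B" for i using xs(2) set_drop_subset by metis
        then have "{Z. Z \<subseteq> B \<and> insert e Z \<in> X} = (\<lambda>i. set (drop i xs)) ` {..n}" using high by auto
        then show ?thesis by (simp add: image_image)
      qed
      ultimately show ?thesis by simp
    qed
    then show False using lcf[of "xs @ [e]"] xs psubset.prems long by simp
  qed
qed

text \<open>The case of base vertex \<open>{}\<close>, translated by \<open>u\<close>: the edges in
  direction \<open>e\<close> at \<open>u\<close> and \<open>v\<close> become those at
  \<open>{}\<close> and \<open>u \<triangle> v\<close>.\<close>

lemma parallel_edges_step: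
  assumes iso: "isometric_family X" and lcf: "long_cycle_free X"
    and uv: "u \<in> X" "v \<in> X" "finite (u \<triangle> v)" "u \<noteq> v"
    and e: "e \<notin> u \<triangle> v" "u \<triangle> {e} \<in> X" "v \<triangle> {e} \<in> X"
  shows "\<exists>a\<in>u \<triangle> v. u \<triangle> {a} \<in> X \<and> u \<triangle> {a} \<triangle> {e} \<in> X"
proof -
  have "insert e (u \<triangle> v) = (u \<triangle> v) \<triangle> {e}" using e(1) by (subst sdiff_singleton) simp
  then have "u \<triangle> insert e (u \<triangle> v) = v \<triangle> {e}" by (simp flip: sdiff_assoc)
  then have "\<exists>a\<in>u \<triangle> v. {a} \<in> {Z. u \<triangle> Z \<in> X} \<and> {a, e} \<in> {Z. u \<triangle> Z \<in> X}"
    using uv e lcf unfolding long_cycle_free_def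
    by (intro parallel_edges_step_at_empty isometric_family_translate iso) simp_all
  then obtain a where a: "a \<in> u \<triangle> v" "u \<triangle> {a} \<in> X" "u \<triangle> {a, e} \<in> X" by blast
  moreover have "{a, e} = {a} \<triangle> {e}" using a(1) e(1) by (auto simp: sdiff_singleton)
  ultimately show ?thesis by (auto simp: sdiff_assoc)
qed

section \<open>Straight paths are geodesics\<close>

text \<open>Isometry leads from \<open>A\<close> to \<open>B\<close> by removing one difference at a
  time, so \<open>e\<close> is changed at some step; \<open>z\<close> is the set just before
  it.\<close>

lemma isometric_family_crossing:
  assumes iso: "isometric_family X"
    and "A \<in> X" "B \<in> X" "finite (A \<triangle> B)" "e \<in> A \<triangle> B"
  shows "\<exists>z\<in>X. z \<triangle> {e} \<in> X \<and> A \<triangle> z \<subseteq> A \<triangle> B - {e}"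
  using assms(2-)
proof (induction "card (A \<triangle> B)" arbitrary: A rule: less_induct)
  case less
  then have "A \<noteq> B" by auto
  then obtain a where a: "a \<in> A \<triangle> B" "A \<triangle> {a} \<in> X"
    using isometric_familyD[OF iso less.prems(1,2)] by blast
  show ?case
  proof (cases "a = e")
    case True
    then show ?thesis using a less.prems by (intro bexI[of _ A]) auto
  next
    case False
    have sub: "A \<triangle> {a} \<triangle> B \<subset> A \<triangle> B" using a by auto
    have "\<exists>z\<in>X. z \<triangle> {e} \<in> X \<and> A \<triangle> {a} \<triangle> z \<subseteq> A \<triangle> {a} \<triangle> B - {e}"
    proof (rule less.hyps)
      show "card (A \<triangle> {a} \<triangle> B) < card (A \<triangle> B)"
        using sub less.prems by (intro psubset_card_mono)
      show "finite (A \<triangle> {a} \<triangle> B)" using sub less.prems finite_subset by blast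
    qed (use a less.prems False in auto)
    then obtain z where z: "z \<in> X" "z \<triangle> {e} \<in> X" "A \<triangle> {a} \<triangle> z \<subseteq> A \<triangle> {a} \<triangle> B - {e}"
      by blast
    have "A \<triangle> z \<subseteq> insert a (A \<triangle> {a} \<triangle> z)" by auto
    also have "\<dots> \<subseteq> A \<triangle> B - {e}" using z(3) sub a False by auto
    finally show ?thesis using z by blast
  qed
qed

text \<open>A path without two consecutive edges in a common square is a geodesic, and its first step is
  forced. Otherwise some edge between its ends is parallel to the first edge, and
  \<open>parallel_edges_step\<close> puts the first two edges of the path into a square.\<close>

lemma straight_path_geodesic:
  assumes iso: "isometric_family X" and lcf: "long_cycle_free X"
    and fin: "\<And>A. A \<in> X \<Longrightarrow> finite A"
    and pX: "\<And>i. p i \<in> X" and pS: "\<And>i. p (Suc i) = p i \<triangle> {a i}"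
    and ne: "\<And>i. a (Suc i) \<noteq> a i" and no_square: "\<And>i. p i \<triangle> {a (Suc i)} \<notin> X"
  shows "card (p i \<triangle> p (i + k)) = k \<and> (k > 0 \<longrightarrow> a i \<in> p i \<triangle> p (i + k)) \<and>
    (\<forall>b\<in>p i \<triangle> p (i + k). p i \<triangle> {b} \<in> X \<longrightarrow> b = a i)"
proof (induction k arbitrary: i rule: less_induct)
  case (less k)
  have finp: "finite (p i \<triangle> p j)" for i j using fin pX by simp
  consider "k = 0" | "k = 1" | m where "k = Suc (Suc m)" by (metis One_nat_def not0_implies_Suc)
  then show ?case
  proof cases
    case 2
    then have "p i \<triangle> p (i + k) = {a i}" by (simp add: pS)
    then show ?thesis using 2 by simp
  next
    case (3 m)
    \<comment> \<open>On the path, \<open>u\<close> is the second vertex, \<open>v\<close> the last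
      but one and \<open>t\<close> the last. The induction hypothesis serves the three shorter parts
      from \<open>p i\<close> to \<open>v\<close>, from \<open>u\<close> to \<open>t\<close> and
      from \<open>u\<close> to \<open>v\<close>.\<close>
    define e where "e = a i"
    define u where "u = p (Suc i)"
    define v where "v = p (Suc i + m)"
    define t where "t = p (Suc i + Suc m)"
    have t: "t = p (i + k)" "t = v \<triangle> {a (Suc i + m)}" using 3 pS by (simp_all add: t_def v_def)
    have u: "u = p i \<triangle> {e}" using pS by (simp add: u_def e_def)
    have IH0: "card (p i \<triangle> v) = Suc m" "e \<in> p i \<triangle> v"
      using less[of "Suc m" i] 3 by (auto simp: v_def e_def)
    have IH1: "card (u \<triangle> t) = Suc m" "\<And>b. b \<in> u \<triangle> t \<Longrightarrow> u \<triangle> {b} \<in> X \<Longrightarrow> b = a (Suc i)"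
      using less[of "Suc m" "Suc i"] 3 by (auto simp: t_def u_def)
    have IH2: "card (u \<triangle> v) = m" "\<And>b. b \<in> u \<triangle> v \<Longrightarrow> u \<triangle> {b} \<in> X \<Longrightarrow> b = a (Suc i)"
      using less[of m "Suc i"] 3 by (auto simp: v_def u_def)
    have ret: "u \<triangle> {e} = p i" by (simp add: u)
    have square: "u \<triangle> {a (Suc i)} \<triangle> {e} = p i \<triangle> {a (Suc i)}" using u by (simp add: sdiff_ac)
    \<comment> \<open>A second crossing of \<open>e\<close> could only be the last step. For
      \<open>m = 0\<close> two consecutive steps would coincide. Otherwise the first and the last
      edge are parallel, and the square found at \<open>u\<close> must use the forced direction
      \<open>a (Suc i)\<close>, which \<open>no_square\<close> excludes.\<close>
    have fresh: "e \<notin> u \<triangle> t"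
    proof
      assume eut: "e \<in> u \<triangle> t"
      have euv: "e \<notin> u \<triangle> v" using IH0(2) u by auto
      then have ea: "e = a (Suc i + m)" using eut t(2) by auto
      show False
      proof (cases "m = 0")
        case True
        then show ?thesis using ea ne[of i] by (simp add: e_def)
      next
        case False
        then have "u \<noteq> v" using IH2(1) by auto
        then obtain c where "c \<in> u \<triangle> v" "u \<triangle> {c} \<in> X" "u \<triangle> {c} \<triangle> {e} \<in> X"
          using parallel_edges_step[OF iso lcf, of u v e] pX finp euv ret t ea
          unfolding u_def v_def by metis
        with IH2(2) square no_square show False by metis
      qed
    qed
    have it: "p i \<triangle> t = insert e (u \<triangle> t)" using fresh u by (auto simp: sdiff_singleton)
    have "card (p i \<triangle> t) = k"
      using it IH1(1) fresh 3 finp[of "Suc i"] by (simp add: u_def t_def)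
    moreover have "b = e" if b: "b \<in> p i \<triangle> t" "p i \<triangle> {b} \<in> X" for b
    proof (rule ccontr)
      assume be: "b \<noteq> e"
      let ?q = "p i \<triangle> {b}"
      \<comment> \<open>Starting from \<open>?q\<close> instead of \<open>p i\<close> ensures that
        \<open>z\<close> differs from \<open>p i\<close> in \<open>b\<close>, so the edge in
        direction \<open>e\<close> at \<open>z\<close> is not the first edge of the path.\<close>
      have "e \<in> ?q \<triangle> t" using it be by auto
      then obtain z where z: "z \<in> X" "z \<triangle> {e} \<in> X" "?q \<triangle> z \<subseteq> ?q \<triangle> t - {e}"
        using isometric_family_crossing[OF iso b(2), of t e] pX fin b(2) by (auto simp: t)
      have zb: "b \<in> p i \<triangle> z" using z(3) b(1) be by auto
      have zt: "p i \<triangle> z \<subseteq> p i \<triangle> t - {e}"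
      proof
        fix x assume x: "x \<in> p i \<triangle> z"
        show "x \<in> p i \<triangle> t - {e}"
        proof (cases "x = b")
          case True
          then show ?thesis using b be by simp
        next
          case False
          then have "x \<in> ?q \<triangle> z" using x by auto
          then have "x \<in> ?q \<triangle> t - {e}" using z(3) by blast
          then show ?thesis using False by auto
        qed
      qed
      have uz: "u \<triangle> (z \<triangle> {e}) = p i \<triangle> z" unfolding u by (rule set_eqI) auto
      have "u \<noteq> z \<triangle> {e}" using uz zb by auto
      moreover have "u \<in> X" using pX by (simp add: u_def)
      moreover have "e \<notin> u \<triangle> (z \<triangle> {e})" "finite (u \<triangle> (z \<triangle> {e}))"
        using uz zt z fin pX by auto
      \<comment> \<open>The parallel edges from \<open>u\<close> to \<open>p i\<close> and from
        \<open>z \<triangle> {e}\<close> to \<open>z\<close> yield a square at \<open>u\<close>. Its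
        direction \<open>c\<close> separates \<open>u\<close> from \<open>t\<close>, so it is again
        forced to be \<open>a (Suc i)\<close>.\<close>
      ultimately obtain c where c: "c \<in> p i \<triangle> z" "u \<triangle> {c} \<in> X" "u \<triangle> {c} \<triangle> {e} \<in> X"
        using parallel_edges_step[OF iso lcf, of u "z \<triangle> {e}" e] z(1,2) pX[of i] ret uz
        by (metis sdiff_cancel_right)
      have "c \<in> u \<triangle> t" using c(1) zt it by blast
      then show False using IH1(2) c square no_square by metis
    qed
    ultimately show ?thesis using it by (auto simp: t e_def)
  qed auto
qed

section \<open>Directions at a vertex and regular families\<close>

definition dirs :: "'b set set \<Rightarrow> 'b set \<Rightarrow> 'b set" where
  "dirs X A = {a. A \<triangle> {a} \<in> X}"

lemma finite_dirs: "finite X \<Longrightarrow> finite (dirs X A)"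
  unfolding dirs_def by (rule finite_inverse_image[where f = "\<lambda>a. A \<triangle> {a}", simplified])
    (auto simp: inj_on_def)

text \<open>A direction lost along an edge would, by regularity, start an infinite straight path,
  whose vertices get arbitrarily far from the first one; in a finite family of finite sets distances
  are bounded.\<close>

lemma regular_dirs_mono:
  assumes iso: "isometric_family X" and lcf: "long_cycle_free X"
    and finX: "finite X" and fin: "\<And>A. A \<in> X \<Longrightarrow> finite A"
    and reg: "\<And>A. A \<in> X \<Longrightarrow> card (dirs X A) = d"
    and "c \<in> X" "f \<in> dirs X c"
  shows "dirs X c \<subseteq> dirs X (c \<triangle> {f})"
proof (rule ccontr)
  assume bad: "\<not> ?thesis"
  \<comment> \<open>\<open>P\<close> marks an edge along which a direction is lost. \<open>Q\<close>
    says that the next edge starts where this one ends, has another direction and spans no square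
    with it.\<close>
  define P where "P = (\<lambda>(c, f). c \<in> X \<and> f \<in> dirs X c \<and> \<not> dirs X c \<subseteq> dirs X (c \<triangle> {f}))"
  define Q where "Q = (\<lambda>(c, f) (c', g). c' = c \<triangle> {f} \<and> g \<noteq> f \<and> c \<triangle> {g} \<notin> X)"
  have start: "P (c, f)" using bad assms by (simp add: P_def)
  have cont: "\<exists>y. P y \<and> Q x y" if "P x" for x
  proof -
    obtain c f where x: "x = (c, f)" by (cases x)
    with that have c: "c \<in> X" "f \<in> dirs X c" "\<not> dirs X c \<subseteq> dirs X (c \<triangle> {f})"
      by (auto simp: P_def)
    then have cf: "c \<triangle> {f} \<in> X" by (simp add: dirs_def)
    \<comment> \<open>Both direction sets have \<open>d\<close> elements, so a direction is gained
      whenever one is lost.\<close>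
    have "\<not> dirs X (c \<triangle> {f}) \<subseteq> dirs X c"
      using card_subset_eq[OF finite_dirs[OF finX]] reg[OF c(1)] reg[OF cf] c(3) by auto
    then obtain g where g: "g \<in> dirs X (c \<triangle> {f})" "g \<notin> dirs X c" by blast
    \<comment> \<open>The direction \<open>f\<close> leads back to \<open>c\<close>, but is lost
      along \<open>g\<close> because \<open>c \<triangle> {g}\<close> is not in \<open>X\<close>;
      hence the new edge satisfies \<open>P\<close> as well.\<close>
    have "f \<in> dirs X (c \<triangle> {f})" "f \<notin> dirs X (c \<triangle> {f} \<triangle> {g})"
      using c g by (auto simp: dirs_def sdiff_ac)
    then have "P (c \<triangle> {f}, g)" using cf g by (auto simp: P_def)
    moreover have "Q x (c \<triangle> {f}, g)" using g c x by (auto simp: Q_def dirs_def)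
    ultimately show ?thesis by blast
  qed
  obtain s where s: "\<And>n. P (s n) \<and> Q (s n) (s (Suc n))"
    using dependent_nat_choice[of "\<lambda>_. P" "\<lambda>_. Q"] start cont by metis
  have geo: "card (fst (s 0) \<triangle> fst (s (0 + k))) = k" for k
  proof -
    have "card (fst (s 0) \<triangle> fst (s (0 + k))) = k \<and> (k > 0 \<longrightarrow> snd (s 0) \<in> fst (s 0) \<triangle> fst (s (0 + k)))
      \<and> (\<forall>b\<in>fst (s 0) \<triangle> fst (s (0 + k)). fst (s 0) \<triangle> {b} \<in> X \<longrightarrow> b = snd (s 0))"
      by (rule straight_path_geodesic[OF iso lcf fin, where p = "\<lambda>i. fst (s i)" and a = "\<lambda>i. snd (s i)"])
        (use s in \<open>auto simp: P_def Q_def case_prod_unfold\<close>)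
    then show ?thesis by blast
  qed
  have "finite (\<Union>X)" using finX fin by blast
  moreover have "fst (s 0) \<triangle> fst (s k) \<subseteq> \<Union>X" for k
    using s[of 0] s[of k] by (auto simp: P_def case_prod_unfold)
  ultimately have "card (fst (s 0) \<triangle> fst (s k)) \<le> card (\<Union>X)" for k
    by (rule card_mono)
  from this[of "Suc (card (\<Union>X))"] geo[of "Suc (card (\<Union>X))"] show False by simp
qed

text \<open>Monotonicity applies to an edge both ways, so all vertices have the directions of
  \<open>c\<close>. Following any of these in turn never leaves \<open>X\<close>, and every vertex
  differs from \<open>c\<close> only in such directions.\<close>

lemma regular_family_is_cube:
  assumes iso: "isometric_family X" and lcf: "long_cycle_free X"
    and finX: "finite X" and fin: "\<And>A. A \<in> X \<Longrightarrow> finite A"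
    and reg: "\<And>A. A \<in> X \<Longrightarrow> card (dirs X A) = d" and c: "c \<in> X"
  shows "X = (\<lambda>Z. c \<triangle> Z) ` Pow (dirs X c)"
proof -
  have mono: "dirs X A \<subseteq> dirs X (A \<triangle> {a})" if "A \<in> X" "A \<triangle> {a} \<in> X" for A a
    using regular_dirs_mono[OF iso lcf finX fin reg] that by (simp add: dirs_def)
  \<comment> \<open>The first step \<open>a\<close> towards \<open>c\<close> is a direction at
    \<open>A\<close>; the remaining differences are directions at \<open>A \<triangle> {a}\<close>
    by induction, and \<open>mono\<close> brings them back to \<open>A\<close>.\<close>
  have "A \<triangle> c \<subseteq> dirs X A" if "A \<in> X" for A
    using that
  proof (induction "card (A \<triangle> c)" arbitrary: A rule: less_induct)
    case less
    show ?case
    proof (cases "A = c")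
      case False
      then obtain a where a: "a \<in> A \<triangle> c" "A \<triangle> {a} \<in> X"
        using isometric_familyD[OF iso less.prems c] by blast
      have "A \<triangle> {a} \<triangle> c \<subset> A \<triangle> c" using a by auto
      then have "card (A \<triangle> {a} \<triangle> c) < card (A \<triangle> c)"
        using less.prems c fin by (intro psubset_card_mono) auto
      then have "A \<triangle> {a} \<triangle> c \<subseteq> dirs X (A \<triangle> {a})" using less a by blast
      also have "\<dots> \<subseteq> dirs X A" using mono[of "A \<triangle> {a}" a] a less.prems by simp
      finally have "insert a (A \<triangle> {a} \<triangle> c) \<subseteq> dirs X A" using a by (simp add: dirs_def)
      then show ?thesis by auto
    qed simp
  qed
  moreover have const: "dirs X A = dirs X c" if "A \<in> X" for A
    using that
  proof (induction "card (A \<triangle> c)" arbitrary: A rule: less_induct)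
    case less
    show ?case
    proof (cases "A = c")
      case False
      then obtain a where a: "a \<in> A \<triangle> c" "A \<triangle> {a} \<in> X"
        using isometric_familyD[OF iso less.prems c] by blast
      have "A \<triangle> {a} \<triangle> c \<subset> A \<triangle> c" using a by auto
      then have "card (A \<triangle> {a} \<triangle> c) < card (A \<triangle> c)"
        using less.prems c fin by (intro psubset_card_mono) auto
      then have "dirs X (A \<triangle> {a}) = dirs X c" using less a by blast
      then show ?thesis using mono[of A a] mono[of "A \<triangle> {a}" a] a less.prems by auto
    qed simp
  qed
  ultimately have sub: "c \<triangle> A \<subseteq> dirs X c" if "A \<in> X" for A
    using that sdiff_commute by metis
  have "c \<triangle> Z \<in> X" if "finite Z" "Z \<subseteq> dirs X c" for Z
    using that
  proof (induction Z rule: finite_induct)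
    case (insert a Z)
    then have "a \<in> dirs X (c \<triangle> Z)" using const by auto
    moreover have "c \<triangle> insert a Z = c \<triangle> Z \<triangle> {a}" using insert.hyps by (auto simp: sdiff_singleton)
    ultimately show ?case by (simp add: dirs_def)
  qed (use c in simp)
  then have "(\<lambda>Z. c \<triangle> Z) ` Pow (dirs X c) \<subseteq> X"
    using finite_dirs[OF finX] finite_subset by blast
  moreover have "A \<in> (\<lambda>Z. c \<triangle> Z) ` Pow (dirs X c)" if "A \<in> X" for A
    by (rule image_eqI[of _ _ "c \<triangle> A"]) (use sub[OF that] in auto)
  ultimately show ?thesis by blast
qed

section \<open>Graphs labelled by sets\<close>

lemma sdiff_card_triangle:
  assumes "finite A" "finite B" "finite C"
  shows "card (A \<triangle> C) \<le> card (A \<triangle> B) + card (B \<triangle> C)"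
proof -
  have "A \<triangle> C \<subseteq> (A \<triangle> B) \<union> (B \<triangle> C)" by auto
  then have "card (A \<triangle> C) \<le> card ((A \<triangle> B) \<union> (B \<triangle> C))" using assms by (intro card_mono) auto
  then show ?thesis using card_Un_le[of "A \<triangle> B" "B \<triangle> C"] by linarith
qed

text \<open>\<open>A \<triangle> C\<close> lies in the union of the two other differences, and
  equality in the triangle inequality leaves no room for further elements in that union.\<close>

lemma sdiff_subset_if_between:
  assumes "finite A" "finite B" "finite C" "card (A \<triangle> B) + card (B \<triangle> C) \<le> card (A \<triangle> C)"
  shows "A \<triangle> B \<subseteq> A \<triangle> C"
proof -
  have "A \<triangle> C \<subseteq> (A \<triangle> B) \<union> (B \<triangle> C)" by auto
  moreover have "card ((A \<triangle> B) \<union> (B \<triangle> C)) \<le> card (A \<triangle> C)"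
    using assms(4) card_Un_le[of "A \<triangle> B" "B \<triangle> C"] by linarith
  ultimately have "A \<triangle> C = (A \<triangle> B) \<union> (B \<triangle> C)"
    using assms by (intro card_seteq) auto
  then show ?thesis by blast
qed

lemma sdiff_card_1_iff: "card (A \<triangle> B) = 1 \<longleftrightarrow> (\<exists>a. B = A \<triangle> {a})"
  by (metis card_1_singletonE is_singletonI is_singleton_altdef sdiff_cancel)

lemma card_image_sdiff:
  assumes "inj_on f (A \<union> B)"
  shows "card (f ` A \<triangle> f ` B) = card (A \<triangle> B)"
proof -
  have "f ` A \<triangle> f ` B = f ` (A \<triangle> B)" using assms by (auto simp: sdiff_def inj_on_def)
  moreover have "inj_on f (A \<triangle> B)" using assms by (rule inj_on_subset) auto
  ultimately show ?thesis by (simp add: card_image)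
qed

text \<open>A finite distance excludes the empty infimum, and a nonempty set of extended naturals
  contains its infimum.\<close>

lemma gdist_attained:
  assumes "gdist V E u v = enat k"
  shows "\<exists>p. is_walk V E p u v \<and> length p - 1 = k"
proof -
  let ?A = "(\<lambda>p. enat (length p - 1)) ` {p. is_walk V E p u v}"
  have "?A \<noteq> {}" using assms unfolding gdist_def Inf_enat_def by (metis enat.distinct(1))
  then have "Inf ?A \<in> ?A" by (metis LeastI_ex Inf_enat_def ex_in_conv)
  then have "enat k \<in> ?A" using assms unfolding gdist_def by simp
  then show ?thesis by auto
qed

lemma is_walk_Cons:
  assumes "is_walk V E p w v" "(u, w) \<in> E" "u \<in> V"
  shows "is_walk V E (u # p) u v"
  using assms unfolding is_walk_def by (auto simp: nth_Cons hd_conv_nth split: nat.split)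

text \<open>\<open>\<phi>\<close> embeds the graph isometrically into the cube of all finite sets of naturals.\<close>

locale cube_labelling =
  fixes V :: "'a set" and E :: "('a \<times> 'a) set" and \<phi> :: "'a \<Rightarrow> nat set"
  assumes inj: "inj_on \<phi> V"
    and edge_iff: "\<And>u v. (u, v) \<in> E \<longleftrightarrow> u \<in> V \<and> v \<in> V \<and> card (\<phi> u \<triangle> \<phi> v) = 1"
    and iso: "isometric_family (\<phi> ` V)"
    and finV: "finite V"
    and fin: "\<And>v. v \<in> V \<Longrightarrow> finite (\<phi> v)"
begin

lemma walk_sdiff_le:
  assumes p: "is_walk V E p u v" and ij: "i \<le> j" "j < length p"
  shows "card (\<phi> (p ! i) \<triangle> \<phi> (p ! j)) \<le> j - i"
  using ij
proof (induction j rule: dec_induct)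
  case (step j)
  have V: "p ! k \<in> V" if "k < length p" for k
    using p that unfolding is_walk_def by (auto dest: nth_mem)
  have "(p ! j, p ! Suc j) \<in> E" using p step.prems unfolding is_walk_def by blast
  then have "card (\<phi> (p ! j) \<triangle> \<phi> (p ! Suc j)) = 1" using edge_iff by blast
  moreover have "card (\<phi> (p ! i) \<triangle> \<phi> (p ! Suc j))
      \<le> card (\<phi> (p ! i) \<triangle> \<phi> (p ! j)) + card (\<phi> (p ! j) \<triangle> \<phi> (p ! Suc j))"
    using V step by (intro sdiff_card_triangle fin) auto
  ultimately show ?case using step by simp
qed simp

lemma walk_length_ge:
  assumes "is_walk V E p u v"
  shows "card (\<phi> u \<triangle> \<phi> v) \<le> length p - 1"
  using walk_sdiff_le[OF assms, of 0 "length p - 1"] assms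
  unfolding is_walk_def by (auto simp: hd_conv_nth last_conv_nth)

text \<open>Isometry provides a neighbour of \<open>u\<close> that is closer to \<open>v\<close> by
  one.\<close>

lemma walk_of_sdiff_length:
  assumes "u \<in> V" "v \<in> V"
  shows "\<exists>p. is_walk V E p u v \<and> length p = Suc (card (\<phi> u \<triangle> \<phi> v))"
  using assms
proof (induction "card (\<phi> u \<triangle> \<phi> v)" arbitrary: u rule: less_induct)
  case less
  show ?case
  proof (cases "u = v")
    case True
    then show ?thesis using less.prems by (intro exI[of _ "[u]"]) (simp add: is_walk_def)
  next
    case False
    then have "\<phi> u \<noteq> \<phi> v" using inj less.prems by (auto simp: inj_on_def)
    then obtain a where a: "a \<in> \<phi> u \<triangle> \<phi> v" "\<phi> u \<triangle> {a} \<in> \<phi> ` V"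
      using isometric_familyD[OF iso, of "\<phi> u" "\<phi> v"] less.prems by blast
    then obtain w where w: "w \<in> V" "\<phi> w = \<phi> u \<triangle> {a}" by auto
    have "\<phi> w \<triangle> \<phi> v = \<phi> u \<triangle> \<phi> v - {a}" using a w by auto
    then have c: "Suc (card (\<phi> w \<triangle> \<phi> v)) = card (\<phi> u \<triangle> \<phi> v)"
      using card_Suc_Diff1[OF _ a(1)] fin less.prems by simp
    then obtain p where p: "is_walk V E p w v" "length p = Suc (card (\<phi> w \<triangle> \<phi> v))"
      using less.hyps[of w] less.prems w by auto
    have "(u, w) \<in> E" using edge_iff less.prems w sdiff_card_1_iff by blast
    then have "is_walk V E (u # p) u v" using is_walk_Cons p less.prems by metis
    then show ?thesis using p c by (intro exI[of _ "u # p"]) simp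
  qed
qed

lemma gdist_eq:
  assumes "u \<in> V" "v \<in> V"
  shows "gdist V E u v = enat (card (\<phi> u \<triangle> \<phi> v))"
proof (rule antisym)
  obtain p where "is_walk V E p u v" "length p = Suc (card (\<phi> u \<triangle> \<phi> v))"
    using walk_of_sdiff_length assms by blast
  then show "gdist V E u v \<le> enat (card (\<phi> u \<triangle> \<phi> v))"
    unfolding gdist_def by (intro INF_lower2[of p]) auto
  show "enat (card (\<phi> u \<triangle> \<phi> v)) \<le> gdist V E u v"
    unfolding gdist_def by (intro INF_greatest) (use walk_length_ge in auto)
qed

text \<open>Each edge changes one element, so the two parts of the path bound the distances of
  \<open>w\<close> from both ends; on a shortest path this forces equality in the triangle
  inequality.\<close>

lemma shortest_path_between:
  assumes p: "shortest_path V E p u v" and uv: "u \<in> V" "v \<in> V" and w: "w \<in> set p"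
  shows "\<phi> u \<triangle> \<phi> w \<subseteq> \<phi> u \<triangle> \<phi> v"
proof -
  have walk: "is_walk V E p u v" and len: "length p - 1 = card (\<phi> u \<triangle> \<phi> v)"
    using p uv by (auto simp: shortest_path_def gdist_eq)
  obtain i where i: "i < length p" "p ! i = w" using w by (auto simp: in_set_conv_nth)
  have ends: "p ! 0 = u" "p ! (length p - 1) = v"
    using walk unfolding is_walk_def by (auto simp: hd_conv_nth last_conv_nth)
  have "card (\<phi> u \<triangle> \<phi> w) \<le> i" "card (\<phi> w \<triangle> \<phi> v) \<le> length p - 1 - i"
    using walk_sdiff_le[OF walk, of 0 i] walk_sdiff_le[OF walk, of i "length p - 1"] i ends by auto
  then show ?thesis using len i w walk uv
    by (intro sdiff_subset_if_between fin) (auto simp: is_walk_def)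
qed

text \<open>Closure under intervals of the cube keeps every shortest path of \<open>V\<close> inside
  \<open>C\<close>; in particular distances do not grow in \<open>C\<close>, which gives
  isometry.\<close>

lemma convex_induced_subgraph:
  assumes CV: "C \<subseteq> V"
    and closed: "\<And>u v w. u \<in> C \<Longrightarrow> v \<in> C \<Longrightarrow> w \<in> V \<Longrightarrow> \<phi> u \<triangle> \<phi> w \<subseteq> \<phi> u \<triangle> \<phi> v \<Longrightarrow> w \<in> C"
  shows "convex_subgraph C (E \<inter> C \<times> C) V E"
proof -
  have inC: "set p \<subseteq> C \<and> (\<forall>i. Suc i < length p \<longrightarrow> (p ! i, p ! Suc i) \<in> E \<inter> C \<times> C)"
    if "u \<in> C" "v \<in> C" "shortest_path V E p u v" for u v p
  proof -
    have walk: "is_walk V E p u v" using that by (simp add: shortest_path_def)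
    have "set p \<subseteq> C"
      using closed[OF that(1,2)] shortest_path_between[OF that(3)] that walk CV
      unfolding is_walk_def by blast
    moreover have "(p ! i, p ! Suc i) \<in> E \<inter> C \<times> C" if "Suc i < length p" for i
      using walk that \<open>set p \<subseteq> C\<close> nth_mem[of i p] nth_mem[of "Suc i" p]
      unfolding is_walk_def by auto
    ultimately show ?thesis by blast
  qed
  have "gdist C (E \<inter> C \<times> C) u v = gdist V E u v" if uv: "u \<in> C" "v \<in> C" for u v
  proof (rule antisym)
    have "u \<in> V" "v \<in> V" using uv CV by auto
    then obtain p where p: "is_walk V E p u v" "length p - 1 = card (\<phi> u \<triangle> \<phi> v)"
      using gdist_attained[OF gdist_eq] by blast
    then have "shortest_path V E p u v"
      using gdist_eq \<open>u \<in> V\<close> \<open>v \<in> V\<close> by (simp add: shortest_path_def)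
    then have "is_walk C (E \<inter> C \<times> C) p u v"
      using inC[OF uv] p unfolding is_walk_def by blast
    then show "gdist C (E \<inter> C \<times> C) u v \<le> gdist V E u v"
      using p gdist_eq[OF \<open>u \<in> V\<close> \<open>v \<in> V\<close>] unfolding gdist_def[of C]
      by (intro INF_lower2[of p]) auto
    show "gdist V E u v \<le> gdist C (E \<inter> C \<times> C) u v"
      unfolding gdist_def by (rule INF_superset_mono) (use CV in \<open>auto simp: is_walk_def\<close>)
  qed
  then show ?thesis
    using inC CV unfolding convex_subgraph_def isometric_subgraph_def subgraph_def by blast
qed

end

section \<open>Distances along a cycle\<close>

text \<open>The closed walk of \<open>cycle_sets\<close> as a function of time
  \<open>t < 2 * length xs\<close>. For distinct nonempty \<open>xs\<close> the sets
  \<open>{}\<close> and \<open>set xs\<close> now occur once each, at times \<open>0\<close> and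
  \<open>length xs\<close>.\<close>

definition cycle_set :: "'b list \<Rightarrow> nat \<Rightarrow> 'b set" where
  "cycle_set xs t = (if t < length xs then set (take t xs) else set (drop (t - length xs) xs))"

lemma cycle_sets_eq:
  assumes "xs \<noteq> []"
  shows "cycle_sets xs = cycle_set xs ` {..<2 * length xs}"
proof (intro equalityI subsetI)
  let ?m = "length xs"
  fix Z assume "Z \<in> cycle_sets xs"
  then consider i where "i < ?m" "Z = set (take i xs)" | "Z = set xs"
    | i where "i < ?m" "Z = set (drop i xs)" | "Z = {}"
    unfolding cycle_sets_def by (auto simp: le_less)
  then show "Z \<in> cycle_set xs ` {..<2 * ?m}"
  proof cases
    case (1 i)
    then show ?thesis by (intro image_eqI[of _ _ i]) (auto simp: cycle_set_def)
  next
    case 2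
    then show ?thesis using assms by (intro image_eqI[of _ _ ?m]) (auto simp: cycle_set_def)
  next
    case (3 i)
    then show ?thesis by (intro image_eqI[of _ _ "?m + i"]) (auto simp: cycle_set_def)
  next
    case 4
    then show ?thesis using assms by (intro image_eqI[of _ _ 0]) (auto simp: cycle_set_def)
  qed
qed (auto simp: cycle_sets_def cycle_set_def)

lemma set_take_nth: "i \<le> length xs \<Longrightarrow> set (take i xs) = (!) xs ` {0..<i}"
  by (metis nth_image)

lemma set_drop_nth: "set (drop i xs) = (!) xs ` {i..<length xs}"
proof (intro equalityI subsetI)
  fix x assume "x \<in> set (drop i xs)"
  then obtain k where "k < length xs - i" "x = xs ! (i + k)" by (auto simp: in_set_conv_nth)
  then show "x \<in> (!) xs ` {i..<length xs}" by (intro image_eqI[of _ _ "i + k"]) auto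
next
  fix x assume "x \<in> (!) xs ` {i..<length xs}"
  then obtain k where "i \<le> k" "k < length xs" "x = xs ! k" by auto
  then show "x \<in> set (drop i xs)" by (auto simp: in_set_conv_nth intro!: exI[of _ "k - i"])
qed

text \<open>The right-hand side is the distance of two positions on a cycle of length
  \<open>2 * length xs\<close>.\<close>

lemma card_cycle_set_sdiff:
  assumes "distinct xs" "s \<le> t" "t < 2 * length xs"
  shows "card (cycle_set xs s \<triangle> cycle_set xs t) = min (t - s) (2 * length xs - (t - s))"
proof -
  let ?m = "length xs"
  \<comment> \<open>The elements present at time \<open>t\<close> occupy an interval of positions in
    \<open>xs\<close>, so only intervals of naturals need to be compared.\<close>
  define I where "I = (\<lambda>t. if t < ?m then {0..<t} else {t - ?m..<?m})"
  have "cycle_set xs r = (!) xs ` I r" for r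
    by (simp add: cycle_set_def I_def set_take_nth set_drop_nth)
  moreover have "inj_on ((!) xs) (I s \<union> I t)"
    using assms by (intro inj_on_subset[OF inj_on_nth[of xs "{..<?m}"]]) (auto simp: I_def)
  ultimately have eq: "card (cycle_set xs s \<triangle> cycle_set xs t) = card (I s \<triangle> I t)"
    by (simp add: card_image_sdiff)
  consider "t < ?m" | "?m \<le> s" | "s < ?m" "?m \<le> t" "s \<le> t - ?m" | "s < ?m" "?m \<le> t" "t - ?m < s"
    by linarith
  then show ?thesis
  proof cases
    case 1
    then have "I s \<triangle> I t = {s..<t}" using assms by (auto simp: I_def sdiff_def)
    then show ?thesis using eq 1 assms by simp
  next
    case 2
    then have "I s \<triangle> I t = {s - ?m..<t - ?m}" using assms by (auto simp: I_def sdiff_def)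
    then show ?thesis using eq 2 assms by simp
  next
    case 3
    then have "I s \<triangle> I t = {0..<s} \<union> {t - ?m..<?m}" using assms by (auto simp: I_def sdiff_def)
    moreover have "card ({0..<s} \<union> {t - ?m..<?m}) = s + (?m - (t - ?m))"
      using 3 by (subst card_Un_disjoint) auto
    ultimately show ?thesis using eq 3 assms by simp
  next
    case 4
    then have "I s \<triangle> I t = {0..<t - ?m} \<union> {s..<?m}" using assms by (auto simp: I_def sdiff_def)
    moreover have "card ({0..<t - ?m} \<union> {s..<?m}) = (t - ?m) + (?m - s)"
      using 4 by (subst card_Un_disjoint) auto
    ultimately show ?thesis using eq 4 assms by simp
  qed
qed

lemma cycle_set_adjacent_iff:
  assumes "distinct xs" "2 \<le> length xs" "s < 2 * length xs" "t < 2 * length xs"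
  shows "card (cycle_set xs s \<triangle> cycle_set xs t) = 1 \<longleftrightarrow>
    t = (s + 1) mod (2 * length xs) \<or> s = (t + 1) mod (2 * length xs)"
proof -
  have *: "card (cycle_set xs s \<triangle> cycle_set xs t) = 1 \<longleftrightarrow>
      t = (s + 1) mod (2 * length xs) \<or> s = (t + 1) mod (2 * length xs)"
    if "s \<le> t" "t < 2 * length xs" for s t
  proof -
    have "(r + 1) mod (2 * length xs) = (if r + 1 = 2 * length xs then 0 else r + 1)"
      if "r < 2 * length xs" for r using that by auto
    then show ?thesis
      using that assms(2) by (auto simp: card_cycle_set_sdiff[OF assms(1) that] min_def)
  qed
  show ?thesis
  proof (cases "s \<le> t")
    case False
    then show ?thesis using *[of t s] assms sdiff_commute by (metis nle_le)
  qed (use * assms in blast)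
qed

lemma inj_on_cycle_set:
  assumes "distinct xs"
  shows "inj_on (cycle_set xs) {..<2 * length xs}"
proof (rule linorder_inj_onI')
  fix s t assume "s \<in> {..<2 * length xs}" "t \<in> {..<2 * length xs}" "s < t"
  then have "card (cycle_set xs s \<triangle> cycle_set xs t) \<noteq> 0"
    using card_cycle_set_sdiff[OF assms, of s t] by auto
  then show "cycle_set xs s \<noteq> cycle_set xs t" by auto
qed

section \<open>Convex cycles, degrees and cubes in a labelled graph\<close>

context cube_labelling
begin

text \<open>The cycle consists of the vertices in the subcube at \<open>\<phi> u\<close> spanned by
  \<open>set xs\<close>. By \<open>eq\<close> they are the positions of the closed walk, adjacent
  iff consecutive; a subcube contains all intervals between its members, which gives
  convexity.\<close>

lemma convex_cycle_of_cycle_sets: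
  assumes u: "u \<in> V" and xs: "distinct xs" "2 \<le> length xs"
    and eq: "{Z. Z \<subseteq> set xs \<and> \<phi> u \<triangle> Z \<in> \<phi> ` V} = cycle_sets xs"
  shows "\<exists>C F. convex_cycle V E C F (2 * length xs)"
proof -
  define l where "l = 2 * length xs"
  define C where "C = {w \<in> V. \<phi> u \<triangle> \<phi> w \<subseteq> set xs}"
  have cyc: "cycle_sets xs = cycle_set xs ` {..<l}"
    unfolding l_def using xs(2) by (intro cycle_sets_eq) auto
  have "\<exists>v\<in>V. \<phi> v = \<phi> u \<triangle> cycle_set xs t" if "t < l" for t
  proof -
    have "cycle_set xs t \<in> cycle_sets xs" using that cyc by blast
    then show ?thesis unfolding eq[symmetric] by auto
  qed
  then obtain g where gV: "\<And>t. t < l \<Longrightarrow> g t \<in> V"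
    and g: "\<And>t. t < l \<Longrightarrow> \<phi> (g t) = \<phi> u \<triangle> cycle_set xs t" by metis
  define c where "c = map g [0..<l]"
  have len: "length c = l" and nth: "\<And>t. t < l \<Longrightarrow> c ! t = g t" by (simp_all add: c_def)
  have "inj_on g {..<l}"
  proof (rule inj_onI)
    fix s t assume st: "s \<in> {..<l}" "t \<in> {..<l}" "g s = g t"
    then have "cycle_set xs s = cycle_set xs t" using g[of s] g[of t] by simp
    then show "s = t" using inj_on_cycle_set[OF xs(1)] st by (auto simp: inj_on_def l_def)
  qed
  then have dist: "distinct c" by (simp add: c_def distinct_map lessThan_atLeast0)
  have set_c: "set c = g ` {..<l}" by (auto simp: c_def)
  have C: "C = set c"
  proof (intro equalityI subsetI)
    fix w assume w: "w \<in> C"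
    then have "\<phi> u \<triangle> \<phi> w \<in> {Z. Z \<subseteq> set xs \<and> \<phi> u \<triangle> Z \<in> \<phi> ` V}" by (simp add: C_def)
    then obtain t where t: "t < l" "\<phi> u \<triangle> \<phi> w = cycle_set xs t" using eq cyc by auto
    then have "\<phi> (g t) = \<phi> w" using g by (metis sdiff_cancel)
    then have "g t = w" using inj gV t w by (auto simp: inj_on_def C_def)
    then show "w \<in> set c" using t set_c by auto
  next
    fix w assume "w \<in> set c"
    then obtain t where t: "t < l" "w = g t" using set_c by auto
    then have "cycle_set xs t \<in> {Z. Z \<subseteq> set xs \<and> \<phi> u \<triangle> Z \<in> \<phi> ` V}" using eq cyc by auto
    then show "w \<in> C" using t g gV by (simp add: C_def)
  qed
  have adj: "(g s, g t) \<in> E \<longleftrightarrow> t = (s + 1) mod l \<or> s = (t + 1) mod l" if "s < l" "t < l" for s t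
    using cycle_set_adjacent_iff[OF xs, of s t] that gV by (simp add: edge_iff g l_def)
  have next_less: "(t + 1) mod l < l" for t using xs(2) by (intro mod_less_divisor) (auto simp: l_def)
  have "E \<inter> C \<times> C = {(c ! i, c ! ((i + 1) mod l)) |i. i < l} \<union> {(c ! ((i + 1) mod l), c ! i) |i. i < l}"
    (is "_ = ?R")
  proof (intro equalityI subsetI)
    fix e assume "e \<in> E \<inter> C \<times> C"
    then obtain s t where st: "s < l" "t < l" "e = (g s, g t)" "(g s, g t) \<in> E"
      using C set_c by auto
    then consider "t = (s + 1) mod l" | "s = (t + 1) mod l" using adj by blast
    then show "e \<in> ?R"
    proof cases
      case 1
      then have "e = (c ! s, c ! ((s + 1) mod l))" using st nth by simp
      then show ?thesis using st by blast
    next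
      case 2
      then have "e = (c ! ((t + 1) mod l), c ! t)" using st nth by simp
      then show ?thesis using st by blast
    qed
  next
    fix e assume "e \<in> ?R"
    then obtain i where i: "i < l" "e = (g i, g ((i + 1) mod l)) \<or> e = (g ((i + 1) mod l), g i)"
      using nth next_less by auto
    then show "e \<in> E \<inter> C \<times> C" using adj next_less[of i] C set_c by auto
  qed
  then have "cycle_graph C (E \<inter> C \<times> C) l"
    using xs(2) len dist C unfolding cycle_graph_def by (auto simp: l_def)
  moreover have "convex_subgraph C (E \<inter> C \<times> C) V E"
  proof (rule convex_induced_subgraph)
    fix a b w assume "a \<in> C" "b \<in> C" "w \<in> V" "\<phi> a \<triangle> \<phi> w \<subseteq> \<phi> a \<triangle> \<phi> b"
    moreover have "\<phi> u \<triangle> \<phi> w \<subseteq> (\<phi> u \<triangle> \<phi> a) \<union> (\<phi> a \<triangle> \<phi> w)"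
      "\<phi> a \<triangle> \<phi> b \<subseteq> (\<phi> u \<triangle> \<phi> a) \<union> (\<phi> u \<triangle> \<phi> b)" by auto
    ultimately show "w \<in> C" unfolding C_def by blast
  qed (simp add: C_def)
  ultimately show ?thesis unfolding convex_cycle_def l_def by blast
qed

text \<open>For a neighbour \<open>u\<close> of \<open>v\<close>,
  \<open>\<phi> v \<triangle> \<phi> u\<close> is the singleton of the direction that leads to
  it.\<close>

lemma card_dirs_eq_degree:
  assumes "v \<in> V"
  shows "card (dirs (\<phi> ` V) (\<phi> v)) = card {u. (v, u) \<in> E}"
proof -
  have "bij_betw (\<lambda>u. \<phi> v \<triangle> \<phi> u) {u. (v, u) \<in> E} ((\<lambda>a. {a}) ` dirs (\<phi> ` V) (\<phi> v))"
    unfolding bij_betw_def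
  proof
    show "inj_on (\<lambda>u. \<phi> v \<triangle> \<phi> u) {u. (v, u) \<in> E}"
      using inj by (auto simp: inj_on_def edge_iff)
    show "(\<lambda>u. \<phi> v \<triangle> \<phi> u) ` {u. (v, u) \<in> E} = (\<lambda>a. {a}) ` dirs (\<phi> ` V) (\<phi> v)"
    proof (intro equalityI subsetI)
      fix Z assume "Z \<in> (\<lambda>u. \<phi> v \<triangle> \<phi> u) ` {u. (v, u) \<in> E}"
      then obtain u a where u: "u \<in> V" "Z = \<phi> v \<triangle> \<phi> u" "\<phi> u = \<phi> v \<triangle> {a}"
        unfolding edge_iff sdiff_card_1_iff by auto
      then have "\<phi> v \<triangle> {a} \<in> \<phi> ` V" by (metis imageI)
      then show "Z \<in> (\<lambda>a. {a}) ` dirs (\<phi> ` V) (\<phi> v)" using u by (auto simp: dirs_def)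
    next
      fix Z assume "Z \<in> (\<lambda>a. {a}) ` dirs (\<phi> ` V) (\<phi> v)"
      then obtain a u where "Z = {a}" "u \<in> V" "\<phi> v \<triangle> {a} = \<phi> u" by (auto simp: dirs_def)
      then have "Z = \<phi> v \<triangle> \<phi> u" "(v, u) \<in> E" using assms by (metis sdiff_cancel,
            metis edge_iff sdiff_card_1_iff)
      then show "Z \<in> (\<lambda>u. \<phi> v \<triangle> \<phi> u) ` {u. (v, u) \<in> E}" by blast
    qed
  qed
  then have "card {u. (v, u) \<in> E} = card ((\<lambda>a. {a}) ` dirs (\<phi> ` V) (\<phi> v))"
    by (rule bij_betw_same_card)
  then show ?thesis by (simp add: card_image)
qed

text \<open>The elements of \<open>D\<close> serve as coordinates: \<open>v\<close> goes to the
  indicator list of \<open>c \<triangle> \<phi> v\<close> along \<open>es\<close>. Hamming distances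
  then equal label distances, which gives injectivity and adjacency.\<close>

lemma graph_iso_cube_of_Pow:
  assumes c: "\<phi> ` V = (\<lambda>Z. c \<triangle> Z) ` Pow D" and D: "finite D"
  shows "graph_iso V E (cube_V (card D)) (cube_E (card D))"
proof -
  obtain es where es: "distinct es" "set es = D" using finite_distinct_list[OF D] by blast
  have len: "length es = card D" using es distinct_card by metis
  define f where "f v = map (\<lambda>a. a \<in> c \<triangle> \<phi> v) es" for v
  have sub: "c \<triangle> \<phi> v \<subseteq> D" if "v \<in> V" for v
  proof -
    have "\<phi> v \<in> (\<lambda>Z. c \<triangle> Z) ` Pow D" using c that by blast
    then show ?thesis by auto
  qed
  have diff: "card {i. i < card D \<and> f u ! i \<noteq> f v ! i} = card (\<phi> u \<triangle> \<phi> v)"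
    if "u \<in> V" "v \<in> V" for u v
  proof -
    have "\<phi> u \<triangle> \<phi> v \<subseteq> (c \<triangle> \<phi> u) \<union> (c \<triangle> \<phi> v)" by auto
    then have "\<phi> u \<triangle> \<phi> v \<subseteq> D" using sub[OF that(1)] sub[OF that(2)] by blast
    moreover have "{i. i < card D \<and> f u ! i \<noteq> f v ! i} = {i. i < length es \<and> es ! i \<in> \<phi> u \<triangle> \<phi> v}"
      using len by (auto simp: f_def)
    ultimately have "(!) es ` {i. i < card D \<and> f u ! i \<noteq> f v ! i} = \<phi> u \<triangle> \<phi> v"
      using es(2) by (force simp: in_set_conv_nth subset_iff)
    moreover have "inj_on ((!) es) {i. i < card D \<and> f u ! i \<noteq> f v ! i}"
      using es len by (intro inj_on_nth) auto
    ultimately show ?thesis by (metis card_image)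
  qed
  have "inj_on f V"
  proof (rule inj_onI)
    fix u v assume uv: "u \<in> V" "v \<in> V" "f u = f v"
    then have "card (\<phi> u \<triangle> \<phi> v) = 0" using diff[of u v] by simp
    then have "\<phi> u = \<phi> v" using fin uv by simp
    then show "u = v" using inj uv by (auto simp: inj_on_def)
  qed
  moreover have "f ` V = cube_V (card D)"
  proof (intro equalityI subsetI)
    fix bs assume "bs \<in> cube_V (card D)"
    then have lb: "length bs = length es" using len by (simp add: cube_V_def)
    define Z where "Z = {es ! i |i. i < length es \<and> bs ! i}"
    have "Z \<subseteq> D" using es by (auto simp: Z_def)
    then obtain v where v: "v \<in> V" "\<phi> v = c \<triangle> Z" using c by (metis Pow_iff imageE imageI)
    have "f v = bs"
    proof (rule nth_equalityI)
      fix i assume "i < length (f v)"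
      then have i: "i < length es" by (simp add: f_def)
      then have "es ! i \<in> Z \<longleftrightarrow> bs ! i"
        using es(1) by (auto simp: Z_def nth_eq_iff_index_eq)
      then show "f v ! i = bs ! i" using v i by (simp add: f_def del: in_sdiff)
    qed (simp add: f_def lb)
    then show "bs \<in> f ` V" using v by blast
  qed (auto simp: cube_V_def f_def len)
  moreover have "(u, v) \<in> E \<longleftrightarrow> (f u, f v) \<in> cube_E (card D)" if "u \<in> V" "v \<in> V" for u v
    using that diff[OF that] len by (simp add: edge_iff cube_E_def f_def)
  ultimately show ?thesis unfolding graph_iso_def bij_betw_def by blast
qed

lemma regular_imp_cube:
  assumes ne: "V \<noteq> {}" and reg: "\<And>v. v \<in> V \<Longrightarrow> card {u. (v, u) \<in> E} = d"
    and cyc: "\<And>C F l. convex_cycle V E C F l \<Longrightarrow> l = 4"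
  shows "graph_iso V E (cube_V d) (cube_E d)"
proof -
  obtain c where c: "c \<in> V" using ne by blast
  have lcf: "long_cycle_free (\<phi> ` V)"
    unfolding long_cycle_free_def
  proof (intro ballI allI impI notI)
    fix U xs assume U: "U \<in> \<phi> ` V" and xs: "distinct xs" "3 \<le> length xs"
      and eq: "{Z. Z \<subseteq> set xs \<and> U \<triangle> Z \<in> \<phi> ` V} = cycle_sets xs"
    obtain u where "u \<in> V" "U = \<phi> u" using U by blast
    then obtain C F where "convex_cycle V E C F (2 * length xs)"
      using convex_cycle_of_cycle_sets[of u xs] xs eq by auto
    then have "2 * length xs = 4" by (rule cyc)
    then show False using xs by simp
  qed
  have deg: "card (dirs (\<phi> ` V) A) = d" if "A \<in> \<phi> ` V" for A
    using that card_dirs_eq_degree reg by auto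
  let ?D = "dirs (\<phi> ` V) (\<phi> c)"
  have "\<phi> ` V = (\<lambda>Z. \<phi> c \<triangle> Z) ` Pow ?D"
    using regular_family_is_cube[OF iso lcf _ _ deg] finV fin c by blast
  then have "graph_iso V E (cube_V (card ?D)) (cube_E (card ?D))"
    using finite_dirs[of "\<phi> ` V"] finV by (intro graph_iso_cube_of_Pow) auto
  then show ?thesis using deg c by simp
qed

section \<open>Convex cycles of cubes\<close>

text \<open>\<open>full\<close> and \<open>S\<close> express that the labels form the cube on
  \<open>S\<close>. Two consecutive edges of the cycle span a square there, whose fourth corner lies
  on a shortest path between their outer ends; convexity puts it on the cycle, which closes after
  four edges.\<close>

lemma cube_convex_cycle_length:
  assumes full: "\<And>u i. u \<in> V \<Longrightarrow> i \<in> S \<Longrightarrow> \<phi> u \<triangle> {i} \<in> \<phi> ` V"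
    and S: "\<And>u. u \<in> V \<Longrightarrow> \<phi> u \<subseteq> S"
    and cyc: "convex_cycle V E C F l"
  shows "l = 4"
proof -
  obtain c where l3: "3 \<le> l" and c: "length c = l" "distinct c" "C = set c"
    and F: "F = {(c ! i, c ! ((i + 1) mod l)) |i. i < l} \<union> {(c ! ((i + 1) mod l), c ! i) |i. i < l}"
    using cyc unfolding convex_cycle_def cycle_graph_def by blast
  have FE: "F \<subseteq> E" and CV: "C \<subseteq> V"
    and conv: "\<And>u v p i. u \<in> C \<Longrightarrow> v \<in> C \<Longrightarrow> shortest_path V E p u v \<Longrightarrow> Suc i < length p
      \<Longrightarrow> (p ! i, p ! Suc i) \<in> F"
    using cyc unfolding convex_cycle_def convex_subgraph_def isometric_subgraph_def subgraph_def
    by blast+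
  have next_mod: "(i + 1) mod l = (if i + 1 = l then 0 else i + 1)" if "i < l" for i
    using that by auto
  have Fc: "t = s + 1 \<or> s = t + 1 \<or> (s = 0 \<and> t + 1 = l) \<or> (t = 0 \<and> s + 1 = l)"
    if st: "(c ! s, c ! t) \<in> F" "s < l" "t < l" for s t
  proof -
    have eq: "c ! a = c ! b \<longleftrightarrow> a = b" if "a < l" "b < l" for a b
      using that c by (simp add: nth_eq_iff_index_eq)
    have lt: "(i + 1) mod l < l" for i using l3 by simp
    from st(1) obtain i where "i < l"
      "(s = i \<and> t = (i + 1) mod l) \<or> (s = (i + 1) mod l \<and> t = i)"
      unfolding F using st(2,3) eq lt by auto
    then show ?thesis using next_mod[of i] by (auto split: if_splits)
  qed
  have inC: "c ! i \<in> C" if "i < l" for i using that c by simp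
  have V: "c ! 0 \<in> V" "c ! 1 \<in> V" "c ! 2 \<in> V" using inC CV l3 by auto
  have "(c ! 0, c ! ((0 + 1) mod l)) \<in> F" "(c ! 1, c ! ((1 + 1) mod l)) \<in> F"
    unfolding F using l3 by auto
  then have "(c ! 0, c ! 1) \<in> E" "(c ! 1, c ! 2) \<in> E" using FE l3 next_mod[of 1] by (auto simp: numeral_2_eq_2)
  then obtain a b where a: "\<phi> (c ! 1) = \<phi> (c ! 0) \<triangle> {a}" and b: "\<phi> (c ! 2) = \<phi> (c ! 1) \<triangle> {b}"
    unfolding edge_iff sdiff_card_1_iff by blast
  have "c ! 0 \<noteq> c ! 2" using c l3 by (simp add: nth_eq_iff_index_eq)
  then have "\<phi> (c ! 0) \<noteq> \<phi> (c ! 2)" using inj V by (auto simp: inj_on_def)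
  then have ab: "a \<noteq> b" using a b by auto
  have "b \<in> \<phi> (c ! 1) \<union> \<phi> (c ! 2)" using b by auto
  then have "b \<in> S" using S V by blast
  \<comment> \<open>\<open>x\<close> is the corner of the square opposite to \<open>c ! 1\<close>,
    reached by taking the directions \<open>a\<close> and \<open>b\<close> in the other
    order.\<close>
  then obtain x where x: "x \<in> V" "\<phi> x = \<phi> (c ! 0) \<triangle> {b}" using full V by (metis imageE)
  have ab2: "\<phi> (c ! 0) \<triangle> \<phi> (c ! 2) = {a, b}" using a b ab by (auto simp: sdiff_ac sdiff_singleton)
  have x2: "\<phi> (c ! 2) = \<phi> x \<triangle> {a}" using a b x by (simp add: sdiff_ac)
  have "is_walk V E [c ! 0, x, c ! 2] (c ! 0) (c ! 2)"
    using V x x2 unfolding is_walk_def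
    by (auto simp: less_Suc_eq edge_iff sdiff_card_1_iff nth_Cons split: nat.split)
  then have sp: "shortest_path V E [c ! 0, x, c ! 2] (c ! 0) (c ! 2)"
    using gdist_eq[OF V(1,3)] ab ab2 by (simp add: shortest_path_def)
  have "(c ! 0, x) \<in> F" "(x, c ! 2) \<in> F"
    using conv[OF inC inC sp, of 0] conv[OF inC inC sp, of 1] l3 by auto
  then obtain k where k: "k < l" "x = c ! k"
    using cyc c unfolding convex_cycle_def convex_subgraph_def isometric_subgraph_def subgraph_def
    by (metis SigmaD2 in_set_conv_nth subset_iff)
  have "x \<noteq> c ! 1" using x a ab by (auto simp: sdiff_cancel_iff)
  then have "k \<noteq> 1" using k by auto
  moreover have "\<not> (c ! 0, c ! 2) \<in> F"
    using FE ab ab2 by (auto simp: edge_iff)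
  \<comment> \<open>Being next to \<open>0\<close> but not \<open>1\<close>, the index
    \<open>k\<close> is \<open>l - 1\<close>; being also next to \<open>2\<close>, it is then
    \<open>3\<close>.\<close>
  ultimately show ?thesis
    using Fc[of 0 k] Fc[of k 2] \<open>(c ! 0, x) \<in> F\<close> \<open>(x, c ! 2) \<in> F\<close> k l3 by auto
qed

end

section \<open>Boolean lists as sets, and labellings of partial cubes\<close>

definition true_positions :: "bool list \<Rightarrow> nat set" where
  "true_positions bs = {i. i < length bs \<and> bs ! i}"

lemma sdiff_true_positions:
  "length xs = n \<Longrightarrow> length ys = n \<Longrightarrow>
    true_positions xs \<triangle> true_positions ys = {i. i < n \<and> xs ! i \<noteq> ys ! i}"
  by (auto simp: true_positions_def)

lemma finite_true_positions [simp]: "finite (true_positions bs)"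
  by (simp add: true_positions_def)

lemma inj_on_true_positions: "inj_on true_positions (cube_V n)"
proof (rule inj_onI)
  fix xs ys assume "xs \<in> cube_V n" "ys \<in> cube_V n" "true_positions xs = true_positions ys"
  then show "xs = ys"
    by (intro nth_equalityI) (auto simp: cube_V_def true_positions_def set_eq_iff)
qed

lemma true_positions_cube_V: "true_positions ` cube_V n = Pow {..<n}"
proof (intro equalityI subsetI)
  fix A assume "A \<in> Pow {..<n}"
  then have "A = true_positions (map (\<lambda>i. i \<in> A) [0..<n])"
    by (auto simp: true_positions_def)
  then show "A \<in> true_positions ` cube_V n"
    by (rule image_eqI) (simp add: cube_V_def)
qed (auto simp: cube_V_def true_positions_def)

lemma cube_E_iff:
  "(xs, ys) \<in> cube_E n \<longleftrightarrow>
    xs \<in> cube_V n \<and> ys \<in> cube_V n \<and> card (true_positions xs \<triangle> true_positions ys) = 1"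
  by (auto simp: cube_E_def cube_V_def sdiff_true_positions)

lemma isometric_family_Pow: "isometric_family (Pow S)"
  unfolding isometric_family_def
proof (intro ballI impI)
  fix A B assume AB: "A \<in> Pow S" "B \<in> Pow S" "A \<noteq> B"
  then obtain a where a: "a \<in> A \<triangle> B" by (metis ex_in_conv sdiff_eq_empty)
  then have "A \<triangle> {a} \<in> Pow S" using AB by auto
  with a show "\<exists>a\<in>A \<triangle> B. A \<triangle> {a} \<in> Pow S" by blast
qed

text \<open>The cube is itself a labelled graph, so \<open>gdist_eq\<close> computes its distances,
  with which those of an isometric subgraph are compared.\<close>

interpretation cube: cube_labelling "cube_V n" "cube_E n" true_positions
proof
  show "finite (cube_V n)"
    unfolding cube_V_def using finite_lists_length_eq[of "UNIV :: bool set" n] by simp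
qed (use inj_on_true_positions cube_E_iff in
    \<open>auto simp: true_positions_cube_V isometric_family_Pow\<close>)

text \<open>Since \<open>H\<close> has the distances of the cube, a shortest walk in
  \<open>H\<close> starts with an edge of \<open>F\<close> that comes one closer to its end. At
  distance one this is the required edge; in general its direction is the witness for
  \<open>isometric_family\<close>.\<close>

lemma cube_labelling_isometric_subgraph:
  assumes "isometric_subgraph H F (cube_V n) (cube_E n)"
  shows "cube_labelling H F true_positions"
proof
  have HV: "H \<subseteq> cube_V n" and FE: "F \<subseteq> cube_E n" and FH: "F \<subseteq> H \<times> H"
    and "\<And>u v. u \<in> H \<Longrightarrow> v \<in> H \<Longrightarrow> gdist H F u v = gdist (cube_V n) (cube_E n) u v"
    using assms unfolding isometric_subgraph_def subgraph_def by auto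
  then have dist: "gdist H F u v = enat (card (true_positions u \<triangle> true_positions v))"
    if "u \<in> H" "v \<in> H" for u v
    using that cube.gdist_eq by (metis subsetD)
  show inj: "inj_on true_positions H" using inj_on_true_positions HV by (rule inj_on_subset)
  show "finite H" using cube.finV HV by (rule finite_subset[rotated])
  have first: "\<exists>w\<in>H. (u, w) \<in> F \<and>
      Suc (card (true_positions w \<triangle> true_positions v)) \<le> card (true_positions u \<triangle> true_positions v)"
    if uv: "u \<in> H" "v \<in> H" "u \<noteq> v" for u v
  proof -
    obtain p where p: "is_walk H F p u v"
      and len: "length p - 1 = card (true_positions u \<triangle> true_positions v)"
      using gdist_attained[OF dist] uv by blast
    have "true_positions u \<noteq> true_positions v" using inj uv by (auto simp: inj_on_def)
    then have "card (true_positions u \<triangle> true_positions v) \<noteq> 0" by simp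
    with len have l2: "1 < length p" by linarith
    have ends: "p ! 0 = u" "p ! (length p - 1) = v"
      using p unfolding is_walk_def by (auto simp: hd_conv_nth last_conv_nth)
    have pF: "(u, p ! 1) \<in> F" using p l2 ends unfolding is_walk_def by auto
    have "is_walk (cube_V n) (cube_E n) p u v" using p HV FE unfolding is_walk_def by blast
    then have "card (true_positions (p ! 1) \<triangle> true_positions v) \<le> length p - 1 - 1"
      using cube.walk_sdiff_le[of n p u v 1 "length p - 1"] l2 ends by simp
    then show ?thesis using pF FH len l2 by (intro bexI[of _ "p ! 1"]) auto
  qed
  show "(u, v) \<in> F \<longleftrightarrow> u \<in> H \<and> v \<in> H \<and> card (true_positions u \<triangle> true_positions v) = 1" for u v
  proof
    assume "(u, v) \<in> F"
    then show "u \<in> H \<and> v \<in> H \<and> card (true_positions u \<triangle> true_positions v) = 1"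
      using FE FH cube_E_iff by blast
  next
    assume R: "u \<in> H \<and> v \<in> H \<and> card (true_positions u \<triangle> true_positions v) = 1"
    then have "u \<noteq> v" by auto
    then obtain w where w: "w \<in> H" "(u, w) \<in> F" "card (true_positions w \<triangle> true_positions v) = 0"
      using first[of u v] R by auto
    then have "w = v" using inj R by (auto simp: inj_on_def)
    then show "(u, v) \<in> F" using w by simp
  qed
  show "isometric_family (true_positions ` H)"
    unfolding isometric_family_def
  proof (intro ballI impI)
    fix A B assume AB: "A \<in> true_positions ` H" "B \<in> true_positions ` H" "A \<noteq> B"
    then obtain u v where uv: "u \<in> H" "v \<in> H" "A = true_positions u" "B = true_positions v" "u \<noteq> v"
      by auto
    then obtain w where w: "w \<in> H" "(u, w) \<in> F"
      "Suc (card (true_positions w \<triangle> B)) \<le> card (A \<triangle> B)" using first by metis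
    then obtain a where a: "true_positions w = A \<triangle> {a}"
      using FE cube_E_iff uv sdiff_card_1_iff by (metis subsetD)
    \<comment> \<open>A step in a direction outside \<open>A \<triangle> B\<close> would increase
      the distance to \<open>B\<close>.\<close>
    have "a \<in> A \<triangle> B"
    proof (rule ccontr)
      assume "a \<notin> A \<triangle> B"
      then have "A \<triangle> B \<subseteq> true_positions w \<triangle> B" using a by auto
      then have "card (A \<triangle> B) \<le> card (true_positions w \<triangle> B)" using uv by (intro card_mono) auto
      then show False using w by simp
    qed
    then show "\<exists>a\<in>A \<triangle> B. A \<triangle> {a} \<in> true_positions ` H" using a w by (metis imageI)
  qed
qed simp

lemma cube_labelling_graph_iso:
  assumes H: "cube_labelling H F \<psi>" and f: "bij_betw f V H"
    and edges: "\<And>u v. u \<in> V \<Longrightarrow> v \<in> V \<Longrightarrow> (u, v) \<in> E \<longleftrightarrow> (f u, f v) \<in> F"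
    and EV: "E \<subseteq> V \<times> V"
  shows "cube_labelling V E (\<lambda>v. \<psi> (f v))"
proof -
  interpret H: cube_labelling H F \<psi> by (rule H)
  have fV: "f ` V = H" and inj: "inj_on f V" using f by (auto simp: bij_betw_def)
  have img: "(\<lambda>v. \<psi> (f v)) ` V = \<psi> ` H" unfolding fV[symmetric] by (simp add: image_image)
  show ?thesis
  proof
    show "inj_on (\<lambda>v. \<psi> (f v)) V"
      using comp_inj_on[OF inj] H.inj fV by (simp add: o_def)
    show "isometric_family ((\<lambda>v. \<psi> (f v)) ` V)" using img H.iso by simp
    show "finite V" using H.finV f bij_betw_finite by blast
    show "(u, v) \<in> E \<longleftrightarrow> u \<in> V \<and> v \<in> V \<and> card (\<psi> (f u) \<triangle> \<psi> (f v)) = 1" for u v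
      using edges[of u v] EV H.edge_iff[of "f u" "f v"] fV by blast
    show "finite (\<psi> (f v))" if "v \<in> V" for v using that H.fin fV by blast
  qed
qed

section \<open>Isomorphisms, small cubes and the characterisation\<close>

lemma graph_iso_trans:
  assumes "graph_iso V E W D" "graph_iso W D X F"
  shows "graph_iso V E X F"
proof -
  obtain f where f: "bij_betw f V W" "\<forall>u\<in>V. \<forall>v\<in>V. (u, v) \<in> E \<longleftrightarrow> (f u, f v) \<in> D"
    using assms(1) unfolding graph_iso_def by blast
  obtain g where g: "bij_betw g W X" "\<forall>u\<in>W. \<forall>v\<in>W. (u, v) \<in> D \<longleftrightarrow> (g u, g v) \<in> F"
    using assms(2) unfolding graph_iso_def by blast
  have "(u, v) \<in> E \<longleftrightarrow> ((g \<circ> f) u, (g \<circ> f) v) \<in> F" if "u \<in> V" "v \<in> V" for u v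
    using that f g by (auto simp: bij_betw_def)
  then show ?thesis
    using bij_betw_trans[OF f(1) g(1)] unfolding graph_iso_def by blast
qed

lemma graph_iso_cube_0: "graph_iso (cube_V 0) (cube_E 0) (K_V 1) (K_E 1)"
  unfolding graph_iso_def
  by (rule exI[of _ "\<lambda>_. 0"]) (auto simp: bij_betw_def cube_V_def cube_E_def K_V_def K_E_def)

lemma graph_iso_cube_1: "graph_iso (cube_V 1) (cube_E 1) (K_V 2) (K_E 2)"
proof -
  let ?f = "\<lambda>bs. if bs ! 0 then 1 else 0 :: nat"
  have V: "cube_V 1 = {[True], [False]}" by (auto simp: cube_V_def length_Suc_conv)
  have E: "(xs, ys) \<in> cube_E 1 \<longleftrightarrow> xs ! 0 \<noteq> ys ! 0" if "xs \<in> cube_V 1" "ys \<in> cube_V 1" for xs ys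
  proof -
    have "{i. i < 1 \<and> xs ! i \<noteq> ys ! i} = (if xs ! 0 \<noteq> ys ! 0 then {0} else {})" by auto
    then show ?thesis using that by (simp add: cube_E_def cube_V_def)
  qed
  have "bij_betw ?f (cube_V 1) (K_V 2)" unfolding V K_V_def by (auto simp: bij_betw_def)
  moreover have "\<forall>u\<in>cube_V 1. \<forall>v\<in>cube_V 1. (u, v) \<in> cube_E 1 \<longleftrightarrow> (?f u, ?f v) \<in> K_E 2"
    using E by (auto simp: K_E_def)
  ultimately show ?thesis unfolding graph_iso_def by blast
qed

theorem theorem1p1:
  fixes V :: "'a set" and E :: "('a \<times> 'a) set"
  assumes "finite_graph V E"
    and "partial_cube V E"
    and "regular V E"
    and "\<not> graph_iso V E (K_V 1) (K_E 1)"
    and "\<not> graph_iso V E (K_V 2) (K_E 2)"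
  shows "(\<forall>C F l. convex_cycle V E C F l \<longrightarrow> l = 4) \<longleftrightarrow>
         (\<exists>k\<ge>2. graph_iso V E (cube_V k) (cube_E k))"
proof -
  have EV: "E \<subseteq> V \<times> V" and ne: "V \<noteq> {}"
    using assms(1) unfolding finite_graph_def simple_graph_def by auto
  show ?thesis
  proof
    assume cyc: "\<forall>C F l. convex_cycle V E C F l \<longrightarrow> l = 4"
    obtain n H F f where H: "isometric_subgraph H F (cube_V n) (cube_E n)"
      and f: "bij_betw f V H" "\<And>u v. u \<in> V \<Longrightarrow> v \<in> V \<Longrightarrow> (u, v) \<in> E \<longleftrightarrow> (f u, f v) \<in> F"
      using assms(2) unfolding partial_cube_def graph_iso_def by blast
    interpret cube_labelling V E "\<lambda>v. true_positions (f v)"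
      using cube_labelling_graph_iso[OF cube_labelling_isometric_subgraph[OF H] f EV] .
    obtain d where "\<And>v. v \<in> V \<Longrightarrow> card {u. (v, u) \<in> E} = d"
      using assms(3) unfolding regular_def by blast
    then have d: "graph_iso V E (cube_V d) (cube_E d)" using cyc by (intro regular_imp_cube ne) auto
    \<comment> \<open>The cubes of dimension \<open>0\<close> and \<open>1\<close> are the complete
      graphs on one and two vertices, which are excluded.\<close>
    moreover have "d \<noteq> 0" using d assms(4) graph_iso_trans[OF _ graph_iso_cube_0] by metis
    moreover have "d \<noteq> 1" using d assms(5) graph_iso_trans[OF _ graph_iso_cube_1] by metis
    ultimately show "\<exists>k\<ge>2. graph_iso V E (cube_V k) (cube_E k)" by (intro exI[of _ d]) auto
  next
    assume "\<exists>k\<ge>2. graph_iso V E (cube_V k) (cube_E k)"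
    then obtain k f where f: "bij_betw f V (cube_V k)"
      "\<And>u v. u \<in> V \<Longrightarrow> v \<in> V \<Longrightarrow> (u, v) \<in> E \<longleftrightarrow> (f u, f v) \<in> cube_E k"
      unfolding graph_iso_def by blast
    interpret cube_labelling V E "\<lambda>v. true_positions (f v)"
      using cube_labelling_graph_iso[OF cube.cube_labelling_axioms f EV] .
    \<comment> \<open>The labels run through all subsets of \<open>{..<k}\<close>, so any element
      below \<open>k\<close> may be toggled without leaving them.\<close>
    have "(\<lambda>v. true_positions (f v)) ` V = true_positions ` f ` V" by (simp add: image_image)
    then have img: "(\<lambda>v. true_positions (f v)) ` V = Pow {..<k}"
      using f(1) by (simp add: bij_betw_def true_positions_cube_V)
    then have sub: "true_positions (f u) \<subseteq> {..<k}" if "u \<in> V" for u using that by blast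
    have "true_positions (f u) \<triangle> {i} \<in> (\<lambda>v. true_positions (f v)) ` V"
      if "u \<in> V" "i \<in> {..<k}" for u i
      unfolding img using sub[OF that(1)] that(2) by (auto simp: sdiff_def)
    then have "l = 4" if "convex_cycle V E C F l" for C F l
      using cube_convex_cycle_length[OF _ sub that] by blast
    then show "\<forall>C F l. convex_cycle V E C F l \<longrightarrow> l = 4" by blast
  qed
qed

end
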